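(* Let $(\mu_t)_{t\ge0}\in\mathfrak{P}_b({\bf M}^0(\mathbb R))$, let $g_t$ be the solution of the associated chordal Löwner equation, $f_t=g_t^{-1}:\mathbb C^+\to\mathbb C^+\setminus\mathcal K_t$, and $G_t(z)=\frac{1}{f_t(z)}$ for $z\in\mathbb C^+$. Then for each $t\in[0,\infty)$ there exists a unique probability measure $\nu_t$ on $\mathbb R$ such that $$G_t(z)=\int_{\mathbb R}\frac{\nu_t(dx)}{z-x},\qquad z\in\mathbb C^+.$$
   Context: Notation: $\mathbb C^+=\{z\in\mathbb C:\mathrm{Im}(z)>0\}$. ${\bf M}^0(\mathbb R)$ is the set of nonzero Borel measures on $\mathbb R$ with finite total mass and bounded support, with the topology of weak convergence. $\mathfrak{P}_b({\bf M}^0(\mathbb R))$ is the set of continuous paths $t\in[0,\infty)\mapsto\mu_t\in{\bf M}^0(\mathbb R)$ with $\sup_{t\ge0}\mu_t(\mathbb R)<\infty$. For $z\in\mathbb C^+$ let $g_t(z)$ solve the chordal Löwner equation $$\partial_t g_t(z)=\int_{\mathbb R}\frac{\mu_t(dx)}{g_t(z)-x},\qquad g_0(z)=z,$$ up to its maximal existence time $T_z\in(0,\infty]$, and let $\mathcal K_t$ be the closure of $\{z\in\mathbb C^+:T_z\le t\}$. Then $g_t$ is a conformal map of $\mathbb C^+\setminus\mathcal K_t$ onto $\mathbb C^+$. *)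

theory Defs
  imports "HOL-Probability.Probability"
begin

definition msupport :: "real measure \<Rightarrow> real set" where
  "msupport M = {x. \<forall>U. open U \<longrightarrow> x \<in> U \<longrightarrow> 0 < emeasure M U}"

definition M0 :: "real measure set" where
  "M0 = {M. finite_borel_measure M \<and> emeasure M UNIV \<noteq> 0 \<and> bounded (msupport M)}"

text \<open>The topology of weak convergence: the coarsest one for which \<open>M \<mapsto> \<integral>x. \<phi> x \<partial>M\<close> is
  continuous for each bounded continuous \<open>\<phi>\<close>. The choice \<open>\<phi> = 0\<close> shows that its space is \<open>M0\<close>.\<close>

definition weak_topology :: "real measure topology" where
  "weak_topology = topology_generated_by
     {{M \<in> M0. (\<integral>x. \<phi> x \<partial>M) \<in> U} | (\<phi> :: real \<Rightarrow> real) U.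
        continuous_on UNIV \<phi> \<and> bounded (range \<phi>) \<and> open U}"

text \<open>Paths are indexed by all of \<open>real\<close>, but only times \<open>t \<ge> 0\<close> matter, here and below.\<close>

definition P_b_M0 :: "(real \<Rightarrow> real measure) set" where
  "P_b_M0 = {\<mu>. continuous_map (top_of_set {0..}) weak_topology \<mu> \<and>
               (SUP t\<in>{0..}. emeasure (\<mu> t) UNIV) < \<infinity>}"

definition upper_half_plane :: "complex set" where
  "upper_half_plane = {z. 0 < Im z}"

text \<open>Solutions live on the half-open interval \<open>[0, T)\<close>, with \<open>T = \<infinity>\<close> allowed, and are required to
  stay in the upper half-plane, so the integrand is bounded. At time \<open>0\<close> the derivative is one-sided.\<close>

definition loewner_solution ::
    "(real \<Rightarrow> real measure) \<Rightarrow> complex \<Rightarrow> ereal \<Rightarrow> (real \<Rightarrow> complex) \<Rightarrow> bool" where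
  "loewner_solution \<mu> z T \<gamma> \<longleftrightarrow>
     \<gamma> 0 = z \<and>
     (\<forall>t. 0 \<le> t \<and> ereal t < T \<longrightarrow>
        \<gamma> t \<in> upper_half_plane \<and>
        (\<gamma> has_vector_derivative (\<integral>x. 1 / (\<gamma> t - complex_of_real x) \<partial>\<mu> t))
          (at t within {s. 0 \<le> s \<and> ereal s < T}))"

definition existence_time :: "(real \<Rightarrow> real measure) \<Rightarrow> complex \<Rightarrow> ereal" where
  "existence_time \<mu> z = Sup {T. \<exists>\<gamma>. loewner_solution \<mu> z T \<gamma>}"

text \<open>The value \<open>g t z\<close> is unconstrained once \<open>t\<close> reaches the maximal existence time of \<open>z\<close>.\<close>

definition loewner_flow ::
    "(real \<Rightarrow> real measure) \<Rightarrow> (real \<Rightarrow> complex \<Rightarrow> complex) \<Rightarrow> bool" where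
  "loewner_flow \<mu> g \<longleftrightarrow>
     (\<forall>z\<in>upper_half_plane. loewner_solution \<mu> z (existence_time \<mu> z) (\<lambda>t. g t z))"

definition loewner_hull :: "(real \<Rightarrow> real measure) \<Rightarrow> real \<Rightarrow> complex set" where
  "loewner_hull \<mu> t = closure {z \<in> upper_half_plane. existence_time \<mu> z \<le> ereal t}"

end

theory Submission
  imports Defs "HOL-Complex_Analysis.Complex_Analysis"
begin

text \<open>
  The map \<open>f\<^sub>t\<close> is the Loewner flow run backwards. For a driving path \<open>\<mu>\<close> write
  \<open>v\<^sub>s(z) = \<integral> \<mu>\<^sub>s(dx) / (z - x)\<close>, so that trajectories solve \<open>\<gamma>'(s) = v\<^sub>s(\<gamma>(s))\<close>. Since \<open>Im v\<^sub>s \<le> 0\<close>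
  on the upper half-plane, following a trajectory backwards in time only pushes it up, away from the
  real line where \<open>v\<close> is singular. Hence through every point \<open>w\<close> of the half-plane at time \<open>t\<close> there
  is a trajectory defined on all of \<open>[0, t]\<close>, and \<open>f\<^sub>t(w)\<close> is its starting point
  (\<open>solution_through_point\<close>, resting on \<open>picard_lindelof_on_interval\<close>).

  Two trajectories satisfy the exact formula
  \<open>a(0) - b(0) = (a(t) - b(t)) exp (\<integral>\<^sub>0\<^sup>t \<integral> \<mu>\<^sub>s(dx) / ((a(s) - x)(b(s) - x)) ds)\<close>
  (\<open>trajectory_difference\<close>). It gives uniqueness of solutions, injectivity of \<open>g\<^sub>t\<close>, and, on letting
  \<open>b\<close> tend to \<open>a\<close>, complex differentiability of \<open>f\<^sub>t\<close>. The open mapping theorem then makes the set of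
  points whose existence time exceeds \<open>t\<close> open, so that it is exactly the half-plane minus the hull. Altogether
  \<open>f\<^sub>t\<close> is holomorphic, \<open>Im f\<^sub>t(w) \<ge> Im w\<close>, and \<open>|f\<^sub>t(w) - w| \<le> B t / Im w\<close> with \<open>B\<close> a bound for the
  masses (\<open>inverse_loewner_map\<close>).

  Therefore \<open>G\<^sub>t = 1 / f\<^sub>t\<close> is holomorphic with negative imaginary part, and \<open>i y G\<^sub>t(i y) \<rightarrow> 1\<close> as
  \<open>y \<rightarrow> \<infinity>\<close>. By Nevanlinna's theorem (\<open>cauchy_transform_representation\<close>) such a function is the Cauchy
  transform of a probability measure: the Cayley transform moves the problem to the unit disc, where
  Herglotz' theorem represents functions of positive real part, and the normalisation at infinity
  rules out an atom at the boundary point corresponding to infinity and fixes the total mass.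

  Uniqueness is Stieltjes inversion (\<open>cauchy_transform_eq_imp_eq\<close>): on the line \<open>Im z = \<epsilon>\<close> the imaginary
  part of the Cauchy transform is a multiple of the convolution with a Cauchy density, whose Fourier transform can be divided out.
\<close>

section \<open>Global solutions of Lipschitz differential equations\<close>

text \<open>The weight \<open>exp (2 L |s - t0|)\<close> is its own antiderivative up to sign and the factor \<open>2 L\<close> on either side
  of \<open>t0\<close>; integrating an \<open>L\<close>-Lipschitz field against it therefore gains a factor \<open>1/2\<close>. The difference of
  the two integrals is the oriented integral from \<open>t0\<close> to \<open>s\<close>.\<close>

lemma exp_weight_integral_bound:
  fixes h :: "real \<Rightarrow> 'a::banach"
  assumes ab: "t0 \<in> {a..b}" "s \<in> {a..b}" and L: "L > 0" and d: "d \<ge> 0"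
    and h: "continuous_on {a..b} h"
    and bd: "\<And>r. r \<in> {a..b} \<Longrightarrow> norm (h r) \<le> L * d * exp (2 * L * \<bar>r - t0\<bar>)"
  shows "norm (integral {a..s} h - integral {a..t0} h) \<le> d / 2 * exp (2 * L * \<bar>s - t0\<bar>)"
proof -
  have int: "h integrable_on {u..v}" if "u \<ge> a" "v \<le> b" for u v
    by (rule integrable_continuous_real, rule continuous_on_subset[OF h]) (use that in auto)
  show ?thesis
  proof (cases "t0 \<le> s")
    case True
    have "integral {a..s} h = integral {a..t0} h + integral {t0..s} h"
      using Henstock_Kurzweil_Integration.integral_combine[of a t0 s h] int[of a s] ab True by auto
    moreover have "norm (integral {t0..s} h) \<le> d / 2 * exp (2 * L * (s - t0)) - d / 2 * exp (2 * L * (t0 - t0))"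
    proof -
      have "((\<lambda>r. L * d * exp (2 * L * (r - t0))) has_integral
           d / 2 * exp (2 * L * (s - t0)) - d / 2 * exp (2 * L * (t0 - t0))) {t0..s}"
        by (rule fundamental_theorem_of_calculus[OF True])
           (auto intro!: derivative_eq_intros simp: has_real_derivative_iff_has_vector_derivative[symmetric])
      moreover have "norm (h r) \<le> L * d * exp (2 * L * (r - t0))" if "r \<in> {t0..s}" for r
        using bd[of r] that ab by auto
      ultimately show ?thesis
        using integral_norm_bound_integral[OF int[of t0 s], of "\<lambda>r. L * d * exp (2 * L * (r - t0))"] ab
        by (auto simp: has_integral_iff)
    qed
    ultimately show ?thesis using True d by simp
  next
    case False
    then have *: "integral {a..t0} h = integral {a..s} h + integral {s..t0} h"
      using Henstock_Kurzweil_Integration.integral_combine[of a s t0 h] int[of a t0] ab by auto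
    moreover have "norm (integral {s..t0} h) \<le> (- (d / 2) * exp (2 * L * (t0 - t0))) - (- (d / 2) * exp (2 * L * (t0 - s)))"
    proof -
      have "((\<lambda>r. L * d * exp (2 * L * (t0 - r))) has_integral
           (- (d / 2) * exp (2 * L * (t0 - t0))) - (- (d / 2) * exp (2 * L * (t0 - s)))) {s..t0}"
        by (rule fundamental_theorem_of_calculus)
           (use False in \<open>auto intro!: derivative_eq_intros simp: has_real_derivative_iff_has_vector_derivative[symmetric]\<close>)
      moreover have "norm (h r) \<le> L * d * exp (2 * L * (t0 - r))" if "r \<in> {s..t0}" for r
        using bd[of r] that ab by auto
      ultimately show ?thesis
        using integral_norm_bound_integral[OF int[of s t0], of "\<lambda>r. L * d * exp (2 * L * (t0 - r))"] ab
        by (auto simp: has_integral_iff)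
    qed
    ultimately show ?thesis using False d by simp
  qed
qed

text \<open>In the norm weighted by \<open>exp (2 L |s - t0|)\<close> (Bielecki's norm) the
  Picard operator is a contraction with factor \<open>1/2\<close>, whatever the length of the interval, so a single
  application of Banach's theorem yields a global solution. The time \<open>t0\<close> may lie inside the interval, so that a
  trajectory can be followed in both directions from a point where it is prescribed.\<close>

lemma picard_lindelof_on_interval:
  fixes F :: "real \<Rightarrow> 'a::banach \<Rightarrow> 'a"
  assumes t0: "t0 \<in> {a..b}"
    and cont: "\<And>z. continuous_on {a..b} (\<lambda>s. F s z)"
    and lip: "\<And>s y z. s \<in> {a..b} \<Longrightarrow> norm (F s y - F s z) \<le> L * norm (y - z)"
  shows "\<exists>\<gamma>. \<gamma> t0 = z0 \<and> (\<forall>s\<in>{a..b}. (\<gamma> has_vector_derivative F s (\<gamma> s)) (at s within {a..b}))"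
proof -
  define M where "M = max L 1"
  have M: "M > 0" "M \<ge> L" by (auto simp: M_def)
  have lipM: "norm (F s y - F s z) \<le> M * norm (y - z)" if "s \<in> {a..b}" for s y z
    by (rule order_trans[OF lip[OF that]]) (use M in \<open>auto intro: mult_right_mono\<close>)
  have "local_lipschitz {a..b} UNIV F"
    by (rule local_lipschitzI, rule exI[of _ 1])
       (use M lipM in \<open>auto simp: lipschitz_on_def dist_norm intro!: exI[of _ M]\<close>)
  then have joint: "continuous_on ({a..b} \<times> UNIV) (\<lambda>(s, z). F s z)"
    using cont by (intro continuous_on_TimesI) auto
  have contF: "continuous_on {a..b} (\<lambda>s. F s (\<gamma> s))" if "continuous_on {a..b} \<gamma>" for \<gamma>
    using continuous_on_compose2[OF joint, of "{a..b}" "\<lambda>s. (s, \<gamma> s)"] that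
    by (simp add: continuous_on_Pair image_subset_iff)
  define \<omega> where "\<omega> s = exp (2 * M * \<bar>s - t0\<bar>)" for s
  have \<omega>pos: "\<omega> s > 0" for s by (simp add: \<omega>_def)
  \<comment> \<open>Clamping time to the interval turns continuous functions there into bounded continuous functions on the line.\<close>
  define c where "c s = max a (min b s)" for s :: real
  have c: "c s \<in> {a..b}" for s using t0 by (auto simp: c_def)
  have cid: "c s = s" if "s \<in> {a..b}" for s using that by (auto simp: c_def)
  \<comment> \<open>The unknown is \<open>u = \<gamma> / \<omega>\<close>, so that the plain supremum norm of \<open>u\<close> is the weighted norm of \<open>\<gamma>\<close>.\<close>
  define H where "H u r = F r (\<omega> r *\<^sub>R apply_bcontfun u r)" for u :: "real \<Rightarrow>\<^sub>C 'a" and r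
  have contH: "continuous_on {a..b} (H u)" for u
    unfolding H_def \<omega>_def by (rule contF) (auto intro!: continuous_intros)
  define J where "J u s = z0 + (integral {a..s} (H u) - integral {a..t0} (H u))" for u s
  have derJ: "(J u has_vector_derivative H u s) (at s within {a..b})" if "s \<in> {a..b}" for u s
    unfolding J_def
    by (auto intro!: derivative_eq_intros integral_has_vector_derivative[OF contH that])
  have contJ: "continuous_on {a..b} (J u)" for u
    using derJ has_vector_derivative_continuous
    by (metis continuous_on_eq_continuous_within)
  define \<Phi> where "\<Phi> u s = J u (c s) /\<^sub>R \<omega> (c s)" for u s
  have "\<Phi> u \<in> bcontfun" for u
  proof -
    have cq: "continuous_on {a..b} (\<lambda>s. J u s /\<^sub>R \<omega> s)"
      unfolding \<omega>_def by (auto intro!: continuous_intros contJ)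
    have "continuous_on UNIV (\<Phi> u)"
      unfolding \<Phi>_def by (rule continuous_on_compose2[OF cq])
        (use c in \<open>auto simp: c_def intro!: continuous_intros\<close>)
    moreover have "bounded (range (\<Phi> u))"
      by (rule bounded_subset[OF compact_imp_bounded[OF compact_continuous_image[OF cq compact_Icc]]])
         (use c in \<open>auto simp: \<Phi>_def\<close>)
    ultimately show ?thesis by (simp add: bcontfun_def)
  qed
  then have app: "apply_bcontfun (Bcontfun (\<Phi> u)) = \<Phi> u" for u
    by (simp add: Bcontfun_inverse)
  have "dist (Bcontfun (\<Phi> u)) (Bcontfun (\<Phi> v)) \<le> 1/2 * dist u v" for u v
  proof (rule dist_bound)
    fix s
    have "norm (integral {a..c s} (\<lambda>r. H u r - H v r) - integral {a..t0} (\<lambda>r. H u r - H v r))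
        \<le> dist u v / 2 * exp (2 * M * \<bar>c s - t0\<bar>)"
    proof (rule exp_weight_integral_bound[OF t0 c M(1)])
      show "continuous_on {a..b} (\<lambda>r. H u r - H v r)"
        by (intro continuous_intros contH)
      fix r assume r: "r \<in> {a..b}"
      have "norm (H u r - H v r) \<le> M * norm (\<omega> r *\<^sub>R apply_bcontfun u r - \<omega> r *\<^sub>R apply_bcontfun v r)"
        unfolding H_def by (rule lipM[OF r])
      also have "\<dots> = M * (\<omega> r * dist (apply_bcontfun u r) (apply_bcontfun v r))"
        using \<omega>pos[of r] by (simp add: dist_norm scaleR_diff_right[symmetric])
      also have "\<dots> \<le> M * (\<omega> r * dist u v)"
        using M \<omega>pos[of r] dist_bounded by (intro mult_left_mono) auto
      finally show "norm (H u r - H v r) \<le> M * dist u v * exp (2 * M * \<bar>r - t0\<bar>)"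
        by (simp add: \<omega>_def mult_ac)
    qed simp
    also have "integral {a..c s} (\<lambda>r. H u r - H v r) - integral {a..t0} (\<lambda>r. H u r - H v r)
       = J u (c s) - J v (c s)"
    proof -
      have "H w integrable_on {a..q}" if "q \<in> {a..b}" for w q
        by (rule integrable_continuous_real, rule continuous_on_subset[OF contH]) (use that in auto)
      then show ?thesis using c[of s] t0
        by (simp add: J_def Henstock_Kurzweil_Integration.integral_diff)
    qed
    finally have *: "norm (J u (c s) - J v (c s)) \<le> dist u v / 2 * \<omega> (c s)"
      by (simp add: \<omega>_def)
    have "dist (\<Phi> u s) (\<Phi> v s) = norm (J u (c s) - J v (c s)) / \<omega> (c s)"
      using \<omega>pos[of "c s"]
      by (simp add: \<Phi>_def dist_norm scaleR_diff_right[symmetric] divide_inverse mult.commute)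
    also have "\<dots> \<le> 1/2 * dist u v"
      using * \<omega>pos[of "c s"] by (simp add: field_simps)
    finally show "dist (apply_bcontfun (Bcontfun (\<Phi> u)) s) (apply_bcontfun (Bcontfun (\<Phi> v)) s) \<le> 1/2 * dist u v"
      by (simp add: app)
  qed
  then have "\<exists>!u. Bcontfun (\<Phi> u) = u"
    by (intro banach_fix_type[of "1/2"]) auto
  then obtain u where u: "Bcontfun (\<Phi> u) = u" by blast
  have eq: "apply_bcontfun u s = J u s /\<^sub>R \<omega> s" if "s \<in> {a..b}" for s
    using app[of u] cid[OF that] by (simp add: u \<Phi>_def)
  have "H u s = F s (J u s)" if "s \<in> {a..b}" for s
    using \<omega>pos[of s] by (simp add: H_def eq[OF that])
  moreover have "J u t0 = z0" by (simp add: J_def)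
  ultimately show ?thesis using derJ[of _ u] by (intro exI[of _ "J u"]) simp
qed

section \<open>Cauchy transforms and Stieltjes inversion\<close>

lemma integrable_cauchy_density:
  "integrable lborel (\<lambda>x::real. inverse (1 + x\<^sup>2))"
  and integral_cauchy_density: "(\<integral>x. inverse (1 + (x::real)\<^sup>2) \<partial>lborel) = pi"
  using integrable_inverse_1_plus_square LBINT_inverse_1_plus_square
  by (simp_all add: set_integrable_def interval_lebesgue_integral_def set_lebesgue_integral_def einterval_def)

text \<open>Every estimate below rests on the distance from \<open>z\<close> to the real line being at least its imaginary part.\<close>

lemma norm_resolvent_le:
  assumes "0 < d" "d \<le> Im z"
  shows "norm (1 / (z - complex_of_real x)) \<le> 1 / d"
proof -
  have "d \<le> \<bar>Im (z - complex_of_real x)\<bar>" using assms by simp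
  also have "\<dots> \<le> norm (z - complex_of_real x)" by (rule abs_Im_le_cmod)
  finally show ?thesis using assms by (simp add: norm_divide frac_le)
qed

lemma (in finite_borel_measure) integrable_resolvent:
  assumes "0 < Im z"
  shows "integrable M (\<lambda>x. 1 / (z - complex_of_real x))"
proof (rule integrable_const_bound[where B = "1 / Im z"])
  show "AE x in M. norm (1 / (z - complex_of_real x)) \<le> 1 / Im z"
    using norm_resolvent_le[OF assms order_refl] by auto
  have "(\<lambda>x. 1 / (z - complex_of_real x)) \<in> borel_measurable borel" by measurable
  then show "(\<lambda>x. 1 / (z - complex_of_real x)) \<in> borel_measurable M"
    by (simp cong: measurable_cong_sets add: M_is_borel)
qed

lemma Im_resolvent: "Im (1 / (Complex a e - complex_of_real x)) = - (e / ((a - x)\<^sup>2 + e\<^sup>2))"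
  by (simp add: Im_divide power2_eq_square)

text \<open>On the line \<open>Im z = e\<close>, minus the imaginary part of the Cauchy transform is the convolution of the
  measure with \<open>e / (a\<^sup>2 + e\<^sup>2)\<close>. Its Fourier transform is thus the product of the characteristic function
  with the Fourier transform of the kernel, which becomes that of \<open>1 / (1 + b\<^sup>2)\<close> at \<open>t e\<close> after rescaling.\<close>

lemma (in real_distribution) poisson_smoothing_char:
  assumes e: "e > 0"
  shows "(\<integral>a. iexp (t * a) * complex_of_real (- Im (\<integral>x. 1 / (Complex a e - complex_of_real x) \<partial>M)) \<partial>lborel)
       = (\<integral>b. iexp (t * e * b) * complex_of_real (inverse (1 + b\<^sup>2)) \<partial>lborel) * char M t"
proof -
  interpret P: pair_sigma_finite M lborel ..
  define p where "p a = e / (a\<^sup>2 + e\<^sup>2)" for a :: real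
  have pos: "a\<^sup>2 + e\<^sup>2 > 0" for a using e by (simp add: add_nonneg_pos)
  have pnn: "p a \<ge> 0" for a using e by (simp add: p_def)
  have pscale: "p (0 + e * b) = inverse (1 + b\<^sup>2) / e" for b
    using e pos[of "e * b"] by (simp add: p_def power_mult_distrib divide_simps add_nonneg_eq_0_iff power2_eq_square) 
       (simp add: algebra_simps)
  have ip: "integrable lborel p"
  proof -
    have "integrable lborel (\<lambda>b. p (0 + e * b))"
      unfolding pscale using integrable_cauchy_density by simp
    then show ?thesis using lborel_integrable_real_affine_iff[of e p 0] e by simp
  qed
  have shift: "(\<integral>a. f a \<partial>lborel) = (\<integral>a. f (x + 1 * a) \<partial>lborel)" for f :: "real \<Rightarrow> complex" and x
    using lborel_integral_real_affine[of 1 f x] by simp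
  have "(\<integral>a. iexp (t * a) * complex_of_real (- Im (\<integral>x. 1 / (Complex a e - complex_of_real x) \<partial>M)) \<partial>lborel)
      = (\<integral>a. (\<integral>x. iexp (t * a) * p (a - x) \<partial>M) \<partial>lborel)"
  proof (rule Bochner_Integration.integral_cong[OF refl])
    fix a
    have "Im (\<integral>x. 1 / (Complex a e - complex_of_real x) \<partial>M)
        = (\<integral>x. - p (a - x) \<partial>M)"
      using integral_Im[OF integrable_resolvent[of "Complex a e"]] e
      by (simp add: Im_resolvent p_def)
    then show "iexp (t * a) * complex_of_real (- Im (\<integral>x. 1 / (Complex a e - complex_of_real x) \<partial>M))
      = (\<integral>x. iexp (t * a) * p (a - x) \<partial>M)" by simp
  qed
  also have "\<dots> = (\<integral>x. (\<integral>a. iexp (t * a) * p (a - x) \<partial>lborel) \<partial>M)"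
  proof (rule P.Fubini_integral, rule P.Fubini_integrable)
    show "(\<lambda>(x, a). iexp (t * a) * complex_of_real (p (a - x))) \<in> borel_measurable (M \<Otimes>\<^sub>M lborel)"
      unfolding p_def by measurable
    have i: "integrable lborel (\<lambda>a. p (a - x))" for x
      using lborel_integrable_real_affine_iff[of 1 p "-x"] ip by simp
    have "(\<integral>a. p (a - x) \<partial>lborel) = (\<integral>a. p a \<partial>lborel)" for x
      using lborel_integral_real_affine[of 1 p "-x"] by simp
    moreover have "norm (iexp (t * a) * complex_of_real (p (a - x))) = p (a - x)" for a x
      using pnn by (simp add: norm_mult)
    ultimately show "integrable M (\<lambda>x. \<integral>a. norm (case (x, a) of (x, a) \<Rightarrow> iexp (t * a) * complex_of_real (p (a - x))) \<partial>lborel)"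
      by simp
    have "integrable lborel (\<lambda>a. iexp (t * a) * complex_of_real (p (a - x)))" for x
    proof (rule Bochner_Integration.integrable_bound[OF i[of x]])
      show "(\<lambda>a. iexp (t * a) * complex_of_real (p (a - x))) \<in> borel_measurable lborel"
        unfolding p_def by measurable
    qed (simp add: norm_mult)
    then show "AE x in M. integrable lborel (\<lambda>a. case (x, a) of (x, a) \<Rightarrow> iexp (t * a) * complex_of_real (p (a - x)))"
      by simp
  qed
  also have "\<dots> = (\<integral>x. iexp (t * x) * (\<integral>b. iexp (t * e * b) * complex_of_real (inverse (1 + b\<^sup>2)) \<partial>lborel) \<partial>M)"
  proof (rule Bochner_Integration.integral_cong[OF refl])
    fix x
    have "(\<integral>a. iexp (t * a) * p (a - x) \<partial>lborel)
        = e *\<^sub>R (\<integral>b. iexp (t * (x + e * b)) * p (0 + e * b) \<partial>lborel)"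
      using lborel_integral_real_affine[of e "\<lambda>a. iexp (t * a) * complex_of_real (p (a - x))" x] e by simp
    also have "\<dots> = (\<integral>b. e *\<^sub>R (iexp (t * (x + e * b)) * p (0 + e * b)) \<partial>lborel)"
      by simp
    also have "\<dots> = (\<integral>b. iexp (t * x) * (iexp (t * e * b) * complex_of_real (inverse (1 + b\<^sup>2))) \<partial>lborel)"
      unfolding pscale using e
      by (intro Bochner_Integration.integral_cong) (auto simp: scaleR_conv_of_real exp_add[symmetric] algebra_simps)
    finally show "(\<integral>a. iexp (t * a) * p (a - x) \<partial>lborel)
        = iexp (t * x) * (\<integral>b. iexp (t * e * b) * complex_of_real (inverse (1 + b\<^sup>2)) \<partial>lborel)"
      by simp
  qed
  also have "\<dots> = (\<integral>b. iexp (t * e * b) * complex_of_real (inverse (1 + b\<^sup>2)) \<partial>lborel) * char M t"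
    by (simp add: char_def mult.commute)
  finally show ?thesis .
qed

text \<open>Divide the product in \<open>poisson_smoothing_char\<close> by the factor that comes from the kernel. For fixed \<open>t\<close>
  this factor tends to \<open>\<pi>\<close> as \<open>e \<rightarrow> 0\<close>, hence is nonzero for some \<open>e > 0\<close>, which is all that is required.\<close>

theorem cauchy_transform_eq_imp_eq:
  assumes M: "real_distribution M" and N: "real_distribution N"
    and eq: "\<And>z. 0 < Im z \<Longrightarrow> (\<integral>x. 1 / (z - complex_of_real x) \<partial>M) = (\<integral>x. 1 / (z - complex_of_real x) \<partial>N)"
  shows "M = N"
proof (rule Levy_uniqueness[OF M N], rule ext)
  fix t
  define c where "c e = (\<integral>b. iexp (t * e * b) * complex_of_real (inverse (1 + b\<^sup>2)) \<partial>lborel)" for e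
  have nrm: "norm (iexp s * complex_of_real (inverse (1 + b\<^sup>2))) = inverse (1 + b\<^sup>2)" for s b
    unfolding norm_mult norm_of_real by (simp add: add_nonneg_nonneg)
  have "(\<lambda>n. c (inverse (real (Suc n)))) \<longlonglongrightarrow> (\<integral>b. complex_of_real (inverse (1 + b\<^sup>2)) \<partial>lborel)"
    unfolding c_def
  proof (rule integral_dominated_convergence[where w = "\<lambda>b. inverse (1 + b\<^sup>2)"])
    show "AE b in lborel. (\<lambda>n. iexp (t * inverse (real (Suc n)) * b) * complex_of_real (inverse (1 + b\<^sup>2)))
        \<longlonglongrightarrow> complex_of_real (inverse (1 + b\<^sup>2))"
    proof (rule AE_I2)
      fix b
      have "(\<lambda>n. t * inverse (real (Suc n)) * b) \<longlonglongrightarrow> t * 0 * b"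
        by (intro tendsto_intros LIMSEQ_inverse_real_of_nat)
      then have "(\<lambda>n. iexp (t * inverse (real (Suc n)) * b) * complex_of_real (inverse (1 + b\<^sup>2)))
        \<longlonglongrightarrow> iexp (t * 0 * b) * complex_of_real (inverse (1 + b\<^sup>2))"
        by (intro tendsto_mult[OF tendsto_exp[OF tendsto_mult[OF tendsto_const]] tendsto_const] tendsto_of_real)
      then show "(\<lambda>n. iexp (t * inverse (real (Suc n)) * b) * complex_of_real (inverse (1 + b\<^sup>2)))
        \<longlonglongrightarrow> complex_of_real (inverse (1 + b\<^sup>2))" by simp
    qed
    show "AE b in lborel. norm (iexp (t * inverse (real (Suc n)) * b) * complex_of_real (inverse (1 + b\<^sup>2)))
        \<le> inverse (1 + b\<^sup>2)" for n
      unfolding nrm by simp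
  qed (use integrable_cauchy_density in simp_all)
  also have "(\<integral>b. complex_of_real (inverse (1 + b\<^sup>2)) \<partial>lborel) = of_real pi"
    using integral_cauchy_density integral_complex_of_real by metis
  finally have "\<forall>\<^sub>F n in sequentially. c (inverse (real (Suc n))) \<noteq> 0"
    by (rule tendsto_imp_eventually_ne) simp
  then obtain n where n: "c (inverse (real (Suc n))) \<noteq> 0"
    by (auto simp: eventually_sequentially)
  define e where "e = inverse (real (Suc n))"
  have e: "e > 0" by (simp add: e_def)
  have "c e * char M t = c e * char N t"
    unfolding c_def real_distribution.poisson_smoothing_char[OF M e, symmetric]
      real_distribution.poisson_smoothing_char[OF N e, symmetric]
    using eq e by simp
  then show "char M t = char N t" using n by (simp add: e_def)
qed

section \<open>Herglotz representation on the disc\<close>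

text \<open>Cauchy's integral formula on the unit circle, with arc length normalised to \<open>1\<close>.\<close>

lemma circle_average_cauchy:
  assumes h: "h holomorphic_on cball 0 1" and u: "norm u < 1"
  shows "((\<lambda>\<theta>. h (cis (2 * pi * \<theta>)) / (1 - u / cis (2 * pi * \<theta>))) has_integral h u) {0..1}"
proof -
  have "((\<lambda>v. h v / (v - u)) has_contour_integral (2 * of_real pi * \<i> * h u)) (circlepath 0 1)"
    by (rule Cauchy_integral_circlepath_simple) (use h u in auto)
  then have "((\<lambda>\<theta>. h (cis (2 * pi * \<theta>)) / (cis (2 * pi * \<theta>) - u) *
       (2 * pi * \<i> * cis (2 * pi * \<theta>))) has_integral (2 * of_real pi * \<i> * h u)) {0..1}"
    unfolding has_contour_integral
  proof (rule has_integral_eq[rotated])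
    fix x :: real
    have "circlepath 0 1 x = cis (2 * pi * x)"
      by (simp add: circlepath cis_conv_exp mult_ac)
    moreover have "vector_derivative (circlepath 0 1) (at x) = 2 * pi * \<i> * cis (2 * pi * x)"
      by (simp add: vector_derivative_circlepath cis_conv_exp mult_ac)
    ultimately show "h (circlepath 0 1 x) / (circlepath 0 1 x - u) * vector_derivative (circlepath 0 1) (at x)
      = h (cis (2 * pi * x)) / (cis (2 * pi * x) - u) * (2 * pi * \<i> * cis (2 * pi * x))"
      by simp
  qed
  from has_integral_mult_right[OF this, of "1 / (2 * of_real pi * \<i>)"]
  have *: "((\<lambda>\<theta>. 1 / (2 * of_real pi * \<i>) * (h (cis (2 * pi * \<theta>)) / (cis (2 * pi * \<theta>) - u) *
       (2 * pi * \<i> * cis (2 * pi * \<theta>)))) has_integral h u) {0..1}"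
    by simp
  show ?thesis
  proof (rule has_integral_eq[OF _ *])
    fix \<theta> :: real
    have "cis (2 * pi * \<theta>) \<noteq> u" using u by (metis norm_cis less_irrefl)
    then show "1 / (2 * of_real pi * \<i>) * (h (cis (2 * pi * \<theta>)) / (cis (2 * pi * \<theta>) - u) *
       (2 * pi * \<i> * cis (2 * pi * \<theta>))) = h (cis (2 * pi * \<theta>)) / (1 - u / cis (2 * pi * \<theta>))"
      by (simp add: field_simps)
  qed
qed

text \<open>A holomorphic function is recovered from the boundary values of its real part. The boundary average of
  \<open>cnj h\<close> against the same kernel sees only \<open>cnj (h 0)\<close>: its conjugate is the average of the
  function \<open>v \<mapsto> h v / (1 - cnj u v)\<close>, holomorphic on the closed disc, that is, the value of this function at \<open>0\<close>.\<close>

lemma schwarz_formula: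
  assumes h: "h holomorphic_on cball 0 1" and u: "norm u < 1"
  shows "((\<lambda>\<theta>. 2 * Re (h (cis (2 * pi * \<theta>))) / (1 - u / cis (2 * pi * \<theta>))) has_integral h u + cnj (h 0)) {0..1}"
proof -
  have nz: "1 - cnj u * v \<noteq> 0" if "norm v \<le> 1" for v
  proof
    assume "1 - cnj u * v = 0"
    then have "norm (cnj u * v) = 1" by simp
    moreover have "norm (cnj u * v) \<le> norm u * 1"
      using mult_left_mono[OF that norm_ge_zero[of u]] by (simp add: norm_mult)
    ultimately show False using u by simp
  qed
  have "(\<lambda>v. h v / (1 - cnj u * v)) holomorphic_on cball 0 1"
    using nz by (intro holomorphic_intros h) auto
  from circle_average_cauchy[OF this, of 0]
  have "((\<lambda>\<theta>. h (cis (2 * pi * \<theta>)) / (1 - cnj u * cis (2 * pi * \<theta>))) has_integral h 0) {0..1}"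
    by simp
  from has_integral_linear[OF this bounded_linear_cnj]
  have "((\<lambda>\<theta>. cnj (h (cis (2 * pi * \<theta>)) / (1 - cnj u * cis (2 * pi * \<theta>)))) has_integral cnj (h 0)) {0..1}"
    by (simp only: o_def)
  then have "((\<lambda>\<theta>. cnj (h (cis (2 * pi * \<theta>))) / (1 - u / cis (2 * pi * \<theta>))) has_integral cnj (h 0)) {0..1}"
    by (simp add: cis_cnj divide_inverse cis_inverse)
  from has_integral_add[OF circle_average_cauchy[OF h u] this]
  show ?thesis
    by (simp add: add_divide_distrib[symmetric] complex_add_cnj)
qed

lemma herglotz_kernel_bound:
  assumes "norm u < 1"
  shows "norm (1 / (1 - u / cis s)) \<le> 1 / (1 - norm u)" "1 - u / cis s \<noteq> 0"
proof -
  have "1 - norm u \<le> norm (1 - u / cis s)"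
    using norm_triangle_ineq2[of 1 "u / cis s"] by (simp add: norm_divide)
  then show "norm (1 / (1 - u / cis s)) \<le> 1 / (1 - norm u)" "1 - u / cis s \<noteq> 0"
    using assms by (auto simp: norm_divide intro: frac_le)
qed

lemma herglotz_kernel_continuous:
  assumes "norm u < 1"
  shows "isCont (\<lambda>\<theta>. 1 / (1 - u / cis (2 * pi * \<theta>))) x"
  using herglotz_kernel_bound(2)[OF assms, of "2 * pi * x"]
  by (intro continuous_intros) (auto simp: cis_conv_exp intro!: continuous_intros)

text \<open>Apply the Schwarz formula on the circles of radius \<open>r < 1\<close>. The densities \<open>Re p (r v) / Re (p 0)\<close> are
  probability densities in the angle, carried by \<open>[0, 1]\<close> and hence tight; by Helly's selection theorem they
  have a weak limit as \<open>r \<rightarrow> 1\<close>, and the kernel is bounded and continuous in the angle. The measure is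
  described on the real line through the parametrisation \<open>\<theta> \<mapsto> cis (2 \<pi> \<theta>)\<close> of the circle.\<close>

theorem herglotz_representation:
  assumes p: "p holomorphic_on ball 0 1" and pos: "\<And>u. norm u < 1 \<Longrightarrow> 0 < Re (p u)"
  shows "\<exists>\<sigma>. real_distribution \<sigma> \<and> (\<forall>u. norm u < 1 \<longrightarrow>
     p u = 2 * Re (p 0) * (\<integral>\<theta>. 1 / (1 - u / cis (2 * pi * \<theta>)) \<partial>\<sigma>) - cnj (p 0))"
proof -
  define m where "m = Re (p 0)"
  have m: "m > 0" using pos[of 0] by (simp add: m_def)
  define r where "r n = real n / real (Suc n)" for n
  have r: "0 \<le> r n" "r n < 1" for n by (auto simp: r_def)
  define h where "h n v = p (complex_of_real (r n) * v)" for n v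
  have rv: "norm (complex_of_real (r n) * v) < 1" if "norm v \<le> 1" for n v
    using r[of n] that mult_left_mono[of "norm v" 1 "r n"] by (simp add: norm_mult)
  have h: "h n holomorphic_on cball 0 1" for n
  proof -
    have "(p \<circ> (\<lambda>v. complex_of_real (r n) * v)) holomorphic_on cball 0 1"
      by (rule holomorphic_on_compose_gen[OF _ p]) (use rv in \<open>auto intro!: holomorphic_intros\<close>)
    then show ?thesis by (simp add: h_def[abs_def] o_def)
  qed
  define w where "w n \<theta> = indicator {0..1} \<theta> * (Re (h n (cis (2 * pi * \<theta>))) / m)" for n and \<theta> :: real
  have wpos: "w n \<theta> \<ge> 0" for n \<theta>
    using pos[OF rv[of "cis (2 * pi * \<theta>)" n]] m by (auto simp: w_def h_def indicator_def)
  have conth: "continuous_on UNIV (\<lambda>\<theta>. h n (cis (2 * pi * \<theta>)))" for n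
    by (rule continuous_on_compose2[OF holomorphic_on_imp_continuous_on[OF h]])
       (auto simp: cis_conv_exp intro!: continuous_intros)
  have wmeas[measurable]: "w n \<in> borel_measurable borel" for n
  proof -
    have [measurable]: "(\<lambda>\<theta>. h n (cis (2 * pi * \<theta>))) \<in> borel_measurable borel"
      by (rule borel_measurable_continuous_onI[OF conth])
    show ?thesis unfolding w_def by measurable
  qed
  have key: "integrable lborel (\<lambda>\<theta>. w n \<theta> *\<^sub>R (1 / (1 - u / cis (2 * pi * \<theta>))))"
    "2 * m * (\<integral>\<theta>. w n \<theta> *\<^sub>R (1 / (1 - u / cis (2 * pi * \<theta>))) \<partial>lborel) = h n u + cnj (h n 0)"
    if u: "norm u < 1" for n and u :: complex
  proof -
    define k where "k \<theta> = (Re (h n (cis (2 * pi * \<theta>))) / m) *\<^sub>R (1 / (1 - u / cis (2 * pi * \<theta>)))" for \<theta>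
    have "continuous_on {0..1} k"
    proof -
      have "continuous_on {0..1} (\<lambda>\<theta>. h n (cis (2 * pi * \<theta>)))"
        by (rule continuous_on_subset[OF conth]) simp
      moreover have "continuous_on {0..1} (\<lambda>\<theta>. 1 / (1 - u / cis (2 * pi * \<theta>)))"
        using herglotz_kernel_continuous[OF u] continuous_at_imp_continuous_on by blast
      ultimately show ?thesis
        unfolding k_def using m
        by (intro continuous_on_scaleR) (auto intro!: continuous_on_divide continuous_on_Re)
    qed
    then have s: "set_integrable lborel {0..1} k" by (rule borel_integrable_atLeastAtMost')
    have eq: "w n \<theta> *\<^sub>R (1 / (1 - u / cis (2 * pi * \<theta>))) = indicator {0..1} \<theta> *\<^sub>R k \<theta>" for \<theta>
      by (simp add: w_def k_def)
    show "integrable lborel (\<lambda>\<theta>. w n \<theta> *\<^sub>R (1 / (1 - u / cis (2 * pi * \<theta>))))"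
      using s unfolding eq set_integrable_def .
    have "(\<integral>\<theta>. w n \<theta> *\<^sub>R (1 / (1 - u / cis (2 * pi * \<theta>))) \<partial>lborel) = integral {0..1} k"
      using set_borel_integral_eq_integral(2)[OF s] by (simp add: eq set_lebesgue_integral_def)
    moreover have "((\<lambda>\<theta>. 2 * m * k \<theta>) has_integral h n u + cnj (h n 0)) {0..1}"
      by (rule has_integral_eq[OF _ schwarz_formula[OF h u]])
         (use m in \<open>simp add: k_def scaleR_conv_of_real\<close>)
    then have "integral {0..1} (\<lambda>\<theta>. 2 * m * k \<theta>) = h n u + cnj (h n 0)"
      by (rule integral_unique)
    ultimately show "2 * m * (\<integral>\<theta>. w n \<theta> *\<^sub>R (1 / (1 - u / cis (2 * pi * \<theta>))) \<partial>lborel) = h n u + cnj (h n 0)"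
      by simp
  qed
  have h0: "h n 0 = p 0" for n by (simp add: h_def)
  define \<sigma> where "\<sigma> n = density lborel (\<lambda>\<theta>. ennreal (w n \<theta>))" for n
  have intw: "integrable lborel (w n)" "(\<integral>\<theta>. w n \<theta> \<partial>lborel) = 1" for n
  proof -
    have i: "integrable lborel (\<lambda>\<theta>. complex_of_real (w n \<theta>))"
      using key(1)[of 0 n] by (simp add: scaleR_conv_of_real)
    then show "integrable lborel (w n)" by (simp add: complex_of_real_integrable_eq)
    have "complex_of_real (2 * m * (\<integral>\<theta>. w n \<theta> \<partial>lborel)) = complex_of_real (2 * m)"
      using key(2)[of 0 n] by (simp add: scaleR_conv_of_real h0 complex_add_cnj m_def)
    then show "(\<integral>\<theta>. w n \<theta> \<partial>lborel) = 1" using m by (simp only: of_real_eq_iff) simp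
  qed
  have rd: "real_distribution (\<sigma> n)" for n
  proof -
    have "prob_space (\<sigma> n)"
      using intw[of n] wpos by (intro prob_spaceI) (simp add: \<sigma>_def emeasure_density nn_integral_eq_integral)
    then show ?thesis by (simp add: real_distribution_def real_distribution_axioms_def \<sigma>_def)
  qed
  have int\<sigma>: "2 * m * (\<integral>\<theta>. 1 / (1 - u / cis (2 * pi * \<theta>)) \<partial>\<sigma> n) = h n u + cnj (h n 0)"
    if u: "norm u < 1" for n and u :: complex
  proof -
    have "(\<lambda>\<theta>. 1 / (1 - u / cis (2 * pi * \<theta>))) \<in> borel_measurable borel"
      by (rule borel_measurable_continuous_onI) 
         (use herglotz_kernel_continuous[OF u] continuous_at_imp_continuous_on in blast)
    then show ?thesis
      unfolding \<sigma>_def by (subst integral_density) (use wpos key(2)[OF u] in auto)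
  qed
  have "tight \<sigma>"
    unfolding tight_def
  proof (intro conjI allI impI rd)
    fix \<epsilon> :: real assume \<epsilon>: "\<epsilon> > 0"
    have "measure (\<sigma> n) {-1<..1} = 1" for n
    proof -
      interpret real_distribution "\<sigma> n" by (rule rd)
      have "AE x in \<sigma> n. x \<in> {-1<..1}"
        unfolding \<sigma>_def
      proof (subst AE_density)
        show "AE x in lborel. 0 < ennreal (w n x) \<longrightarrow> x \<in> {-1<..1}"
          by (auto simp: w_def indicator_def split: if_splits)
      qed measurable
      then show ?thesis by (subst prob_eq_1) auto
    qed
    then show "\<exists>a b. a < b \<and> (\<forall>n. measure (\<sigma> n) {a<..b} > 1 - \<epsilon>)"
      using \<epsilon> by (intro exI[of _ "-1"] exI[of _ 1]) auto
  qed
  from tight_imp_convergent_subsubsequence[OF this strict_mono_id]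
  obtain q S where q: "strict_mono q" and S: "real_distribution S" and conv: "weak_conv_m (\<sigma> \<circ> id \<circ> q) S"
    by blast
  show ?thesis
  proof (intro exI[of _ S] conjI S allI impI)
    fix u :: complex assume u: "norm u < 1"
    have "(\<lambda>n. integral\<^sup>L ((\<sigma> \<circ> id \<circ> q) n) (\<lambda>\<theta>. 1 / (1 - u / cis (2 * pi * \<theta>)))) \<longlonglongrightarrow>
        integral\<^sup>L S (\<lambda>\<theta>. 1 / (1 - u / cis (2 * pi * \<theta>)))"
      by (rule weak_conv_imp_integral_bdd_continuous_conv[OF _ S conv herglotz_kernel_continuous[OF u]
            herglotz_kernel_bound(1)[OF u]]) (simp add: rd)
    then have "(\<lambda>n. 2 * m * integral\<^sup>L (\<sigma> (q n)) (\<lambda>\<theta>. 1 / (1 - u / cis (2 * pi * \<theta>)))) \<longlonglongrightarrow>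
        2 * m * integral\<^sup>L S (\<lambda>\<theta>. 1 / (1 - u / cis (2 * pi * \<theta>)))"
      by (intro tendsto_mult tendsto_const) (simp add: o_def)
    then have "(\<lambda>n. h (q n) u + cnj (p 0)) \<longlonglongrightarrow> 2 * m * integral\<^sup>L S (\<lambda>\<theta>. 1 / (1 - u / cis (2 * pi * \<theta>)))"
      unfolding int\<sigma>[OF u] h0 .
    moreover have "(\<lambda>n. h (q n) u + cnj (p 0)) \<longlonglongrightarrow> p u + cnj (p 0)"
    proof -
      have "r \<longlonglongrightarrow> 1" unfolding r_def by (rule LIMSEQ_n_over_Suc_n)
      then have "(r \<circ> q) \<longlonglongrightarrow> 1" by (rule LIMSEQ_subseq_LIMSEQ[OF _ q])
      then have "(\<lambda>n. complex_of_real (r (q n)) * u) \<longlonglongrightarrow> complex_of_real 1 * u"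
        by (intro tendsto_intros) (simp add: o_def)
      moreover have "isCont p u"
        using holomorphic_on_imp_continuous_on[OF p] u by (simp add: continuous_on_eq_continuous_at)
      ultimately have "(\<lambda>n. p (complex_of_real (r (q n)) * u)) \<longlonglongrightarrow> p u"
        by (intro isCont_tendsto_compose[of u p]) auto
      then show ?thesis unfolding h_def by (intro tendsto_intros)
    qed
    ultimately have "p u + cnj (p 0) = 2 * m * integral\<^sup>L S (\<lambda>\<theta>. 1 / (1 - u / cis (2 * pi * \<theta>)))"
      by (metis LIMSEQ_unique)
    then show "p u = 2 * Re (p 0) * (\<integral>\<theta>. 1 / (1 - u / cis (2 * pi * \<theta>)) \<partial>S) - cnj (p 0)"
      by (simp add: m_def algebra_simps)
  qed
qed

section \<open>Nevanlinna representation on the half-plane\<close>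

text \<open>Homogeneous form of \<open>z \<noteq> x\<close> for a boundary point \<open>x = - cos t / sin t\<close>, where \<open>sin t = 0\<close> stands for
  \<open>x = \<infinity>\<close>.\<close>

lemma mult_sin_add_cos_nonzero:
  assumes "Im z > 0"
  shows "z * complex_of_real (sin t) + complex_of_real (cos t) \<noteq> 0"
proof
  assume eq: "z * complex_of_real (sin t) + complex_of_real (cos t) = 0"
  then have "Im (z * complex_of_real (sin t) + complex_of_real (cos t)) = 0" by simp
  then have "sin t = 0" using assms by simp
  with eq show False using sin_cos_squared_add[of t] by simp
qed

text \<open>The Herglotz kernel seen from the half-plane: under \<open>u = (z - \<i>) / (z + \<i>)\<close> the boundary point
  \<open>cis (2 t)\<close> corresponds to \<open>x = - cot t\<close>. Writing the kernel with \<open>sin\<close> and \<open>cos\<close> in place of \<open>x\<close> keeps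
  the formula valid at \<open>x = \<infinity>\<close>.\<close>

lemma cayley_herglotz_kernel:
  assumes z: "Im z > 0"
  shows "1 / (1 - ((z - \<i>) / (z + \<i>)) / cis (2 * t))
       = (z + \<i>) * cis t / (2 * \<i> * (z * complex_of_real (sin t) + complex_of_real (cos t)))"
proof -
  have zi: "z + \<i> \<noteq> 0" using z by (auto simp: complex_eq_iff)
  define S C where "S = complex_of_real (sin t)" and "C = complex_of_real (cos t)"
  have SC: "S\<^sup>2 + C\<^sup>2 = 1" unfolding S_def C_def
    by (metis of_real_1 of_real_add of_real_power sin_cos_squared_add)
  have c: "cis t = C + \<i> * S" by (simp add: S_def C_def complex_eq_iff)
  have c2: "cis (2 * t) = cis t * cis t" by (simp add: cis_mult)
  have nz: "z * S + C \<noteq> 0" using mult_sin_add_cos_nonzero[OF z] by (simp add: S_def C_def)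
  have cnz: "cis t \<noteq> 0" by simp
  have "(z + \<i>) * cis (2 * t) - (z - \<i>) = 2 * \<i> * cis t * (z * S + C)"
    unfolding c2 c using SC by (simp add: algebra_simps power2_eq_square) algebra
  moreover have "1 - ((z - \<i>) / (z + \<i>)) / cis (2 * t) = ((z + \<i>) * cis (2 * t) - (z - \<i>)) / ((z + \<i>) * cis (2 * t))"
    using zi by (simp add: diff_divide_distrib)
  ultimately have "1 - ((z - \<i>) / (z + \<i>)) / cis (2 * t) = 2 * \<i> * cis t * (z * S + C) / ((z + \<i>) * (cis t * cis t))"
    by (simp add: c2)
  then have "1 / (1 - ((z - \<i>) / (z + \<i>)) / cis (2 * t)) = ((z + \<i>) * (cis t * cis t)) / (2 * \<i> * cis t * (z * S + C))"
    by simp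
  also have "\<dots> = (z + \<i>) * cis t / (2 * \<i> * (z * S + C))"
    using nonzero_mult_divide_mult_cancel_right[OF cnz, of "(z + \<i>) * cis t" "2 * \<i> * (z * S + C)"]
    by (simp only: mult_ac)
  finally show ?thesis by (simp add: S_def C_def)
qed

lemma norm_inverse_cayley_less_1:
  assumes "Im z > 0"
  shows "norm ((z - \<i>) / (z + \<i>)) < 1"
proof -
  have zi: "z + \<i> \<noteq> 0" using assms by (auto simp: complex_eq_iff)
  have "(norm (z - \<i>))\<^sup>2 < (norm (z + \<i>))\<^sup>2"
    unfolding cmod_power2 using assms by (simp add: power2_eq_square algebra_simps)
  then have "norm (z - \<i>) < norm (z + \<i>)" by (rule power_less_imp_less_base) simp
  then show ?thesis using zi by (simp add: norm_divide)
qed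

lemma Im_cayley_pos:
  assumes "norm u < 1"
  shows "Im (\<i> * (1 + u) / (1 - u)) > 0"
proof -
  have "u \<noteq> 1" using assms by auto
  then have p: "(norm (1 - u))\<^sup>2 > 0" by simp
  have "(norm u)\<^sup>2 < 1" using assms by (simp add: power_less_one_iff)
  then have "1 - (Re u)\<^sup>2 - (Im u)\<^sup>2 > 0" by (simp add: cmod_power2)
  moreover have "Im (\<i> * (1 + u) / (1 - u)) = (1 - (Re u)\<^sup>2 - (Im u)\<^sup>2) / (norm (1 - u))\<^sup>2"
    unfolding cmod_power2 by (simp add: Im_divide power2_eq_square algebra_simps)
  ultimately show ?thesis using p by simp
qed

text \<open>Nevanlinna's theorem. Herglotz' theorem applied to \<open>\<i> G\<close> on the disc yields a measure \<open>\<sigma>\<close> on the circle;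
  put \<open>x = - cot (\<pi> \<theta>)\<close>. On the imaginary axis it gives
  \<open>- y Im G(\<i> y) = \<integral> m y\<^sup>2 / (cos\<^sup>2 + y\<^sup>2 sin\<^sup>2) d\<sigma>\<close>, whose left side tends to \<open>1\<close>. At a zero of \<open>sin\<close>, i.e.
  at \<open>x = \<infinity>\<close>, the integrand is \<open>m y\<^sup>2\<close>, so \<open>\<sigma>\<close> has no mass there; elsewhere the integrand increases to
  \<open>m / sin\<^sup>2 = m (1 + x\<^sup>2)\<close>, which therefore has integral \<open>1\<close>. The image of \<open>m (1 + x\<^sup>2) \<sigma>\<close> on the line is the
  measure sought, up to an additive constant that vanishes because both sides tend to \<open>0\<close> along the
  imaginary axis.\<close>

theorem cauchy_transform_representation:
  assumes hol: "G holomorphic_on {z. 0 < Im z}"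
    and neg: "\<And>z. 0 < Im z \<Longrightarrow> Im (G z) < 0"
    and lim: "((\<lambda>y. \<i> * complex_of_real y * G (\<i> * complex_of_real y)) \<longlongrightarrow> 1) at_top"
  shows "\<exists>\<nu>. real_distribution \<nu> \<and> (\<forall>z. 0 < Im z \<longrightarrow> G z = (\<integral>x. 1 / (z - complex_of_real x) \<partial>\<nu>))"
proof -
  define p where "p u = \<i> * G (\<i> * (1 + u) / (1 - u))" for u
  have p_hol: "p holomorphic_on ball 0 1"
  proof -
    have "(G \<circ> (\<lambda>u. \<i> * (1 + u) / (1 - u))) holomorphic_on ball 0 1"
      by (rule holomorphic_on_compose_gen[OF _ hol]) (use Im_cayley_pos in \<open>auto intro!: holomorphic_intros\<close>)
    then show ?thesis unfolding p_def o_def by (intro holomorphic_intros)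
  qed
  have p_pos: "0 < Re (p u)" if "norm u < 1" for u
    using neg[OF Im_cayley_pos[OF that]] by (simp add: p_def)
  define m where "m = Re (p 0)"
  have m: "m > 0" using p_pos[of 0] by (simp add: m_def)
  obtain \<sigma> where rd: "real_distribution \<sigma>"
    and rep: "\<And>u. norm u < 1 \<Longrightarrow> p u = 2 * m * (\<integral>\<theta>. 1 / (1 - u / cis (2 * pi * \<theta>)) \<partial>\<sigma>) - cnj (p 0)"
    using herglotz_representation[OF p_hol p_pos] unfolding m_def by blast
  interpret \<sigma>: real_distribution \<sigma> by (rule rd)
  define S C where "S \<theta> = sin (pi * \<theta>)" and "C \<theta> = cos (pi * \<theta>)" for \<theta>
  have [measurable]: "S \<in> borel_measurable borel" "C \<in> borel_measurable borel"
    unfolding S_def C_def by measurable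
  have SC: "(C \<theta>)\<^sup>2 + (S \<theta>)\<^sup>2 = 1" for \<theta> by (simp add: S_def C_def)
  define k where "k z \<theta> = (z + \<i>) * cis (pi * \<theta>) / (2 * \<i> * (z * complex_of_real (S \<theta>) + complex_of_real (C \<theta>)))" for z \<theta>
  have k_eq: "1 / (1 - ((z - \<i>) / (z + \<i>)) / cis (2 * pi * \<theta>)) = k z \<theta>" if "Im z > 0" for z \<theta>
    using cayley_herglotz_kernel[OF that, of "pi * \<theta>"] by (simp add: k_def S_def C_def mult.assoc)
  have k_int: "integrable \<sigma> (k z)" if z: "Im z > 0" for z
  proof (rule \<sigma>.integrable_const_bound)
    show "AE \<theta> in \<sigma>. norm (k z \<theta>) \<le> 1 / (1 - norm ((z - \<i>) / (z + \<i>)))"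
      using herglotz_kernel_bound(1)[OF norm_inverse_cayley_less_1[OF z]] by (simp add: k_eq[OF z, symmetric])
    have "continuous_on UNIV (k z)"
      using herglotz_kernel_continuous[OF norm_inverse_cayley_less_1[OF z]]
      by (simp only: k_eq[OF z] continuous_on_eq_continuous_at[OF open_UNIV]) blast
    then show "k z \<in> borel_measurable \<sigma>"
      by (simp add: borel_measurable_continuous_onI cong: measurable_cong_sets)
  qed
  have rep': "\<i> * G z = 2 * m * (\<integral>\<theta>. k z \<theta> \<partial>\<sigma>) - cnj (p 0)" if z: "Im z > 0" for z
  proof -
    have "z + \<i> \<noteq> 0" using z by (auto simp: complex_eq_iff)
    then have "1 + (z - \<i>) / (z + \<i>) = 2 * z / (z + \<i>)" "1 - (z - \<i>) / (z + \<i>) = 2 * \<i> / (z + \<i>)"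
      by (simp_all add: divide_simps)
    then have "\<i> * (1 + (z - \<i>) / (z + \<i>)) / (1 - (z - \<i>) / (z + \<i>)) = z"
      using \<open>z + \<i> \<noteq> 0\<close> by simp
    then show ?thesis
      using rep[OF norm_inverse_cayley_less_1[OF z]] unfolding k_eq[OF z] by (simp add: p_def)
  qed

  define P where "P y \<theta> = m * y\<^sup>2 / ((C \<theta>)\<^sup>2 + y\<^sup>2 * (S \<theta>)\<^sup>2)" for y \<theta>
  have Dpos: "(C \<theta>)\<^sup>2 + y\<^sup>2 * (S \<theta>)\<^sup>2 > 0" if "y > 0" for y \<theta>
  proof (cases "S \<theta> = 0")
    case True then show ?thesis using SC[of \<theta>] by simp
  next
    case False then show ?thesis using that by (intro add_nonneg_pos) auto
  qed
  have P: "integrable \<sigma> (P y)" "(\<integral>\<theta>. P y \<theta> \<partial>\<sigma>) = - y * Im (G (\<i> * y))" if y: "y > 0" for y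
  proof -
    have z: "Im (\<i> * complex_of_real y) > 0" using y by simp
    have Pk: "P y \<theta> = y * (2 * m * Re (k (\<i> * y) \<theta>) - m)" for \<theta>
    proof -
      define D where "D = (C \<theta>)\<^sup>2 + y\<^sup>2 * (S \<theta>)\<^sup>2"
      define A B E where "A = \<i> * complex_of_real y * complex_of_real (S \<theta>) + complex_of_real (C \<theta>)"
        and "B = complex_of_real (C \<theta>) - \<i> * complex_of_real (y * S \<theta>)"
        and "E = complex_of_real (C \<theta>) + \<i> * complex_of_real (S \<theta>)"
      have "k (\<i> * y) \<theta> = complex_of_real ((y + 1) / 2) * (E * B) / complex_of_real D"
      proof -
        have c: "cis (pi * \<theta>) = E" by (simp add: S_def C_def E_def complex_eq_iff)
        have n0: "A \<noteq> 0"
          using mult_sin_add_cos_nonzero[OF z, of "pi * \<theta>"] by (simp add: S_def C_def A_def)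
        have e: "complex_of_real D = A * B"
          by (simp add: A_def B_def D_def algebra_simps power2_eq_square)
        have n1: "B \<noteq> 0"
        proof
          assume "B = 0"
          then have "complex_of_real D = 0" unfolding e by simp
          then show False using Dpos[OF y, of \<theta>] by (simp only: of_real_eq_0_iff D_def)
        qed
        have "k (\<i> * y) \<theta> = (\<i> * (complex_of_real y + 1)) * E / (2 * \<i> * A)"
          by (simp add: k_def c A_def distrib_left)
        also have "\<dots> = complex_of_real ((y + 1) / 2) * (E * B) / (A * B)"
          using n0 n1 by simp
        finally show ?thesis unfolding e .
      qed
      then have "Re (k (\<i> * y) \<theta>) = (y + 1) / 2 * Re (E * B) / D"
        by simp
      also have "Re (E * B) = (C \<theta>)\<^sup>2 + y * (S \<theta>)\<^sup>2"
        by (simp add: E_def B_def power2_eq_square)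
      finally have Rk: "Re (k (\<i> * y) \<theta>) = (y + 1) / 2 * ((C \<theta>)\<^sup>2 + y * (S \<theta>)\<^sup>2) / D" .
      have "2 * m * Re (k (\<i> * y) \<theta>) - m = m * ((y + 1) * ((C \<theta>)\<^sup>2 + y * (S \<theta>)\<^sup>2) - D) / D"
        using Dpos[OF y, of \<theta>] unfolding D_def[symmetric] Rk
        by (simp add: field_simps)
      also have "(y + 1) * ((C \<theta>)\<^sup>2 + y * (S \<theta>)\<^sup>2) - D = y * ((C \<theta>)\<^sup>2 + (S \<theta>)\<^sup>2)"
        by (simp add: D_def algebra_simps power2_eq_square)
      finally show ?thesis unfolding SC by (simp add: P_def D_def power2_eq_square)
    qed
    have ik: "integrable \<sigma> (\<lambda>\<theta>. Re (k (\<i> * y) \<theta>))"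
      using k_int[OF z] by (rule integrable_Re)
    then show "integrable \<sigma> (P y)" unfolding Pk[abs_def] by simp
    have "(\<integral>\<theta>. P y \<theta> \<partial>\<sigma>) = y * (2 * m * (\<integral>\<theta>. Re (k (\<i> * y) \<theta>) \<partial>\<sigma>) - m)"
      unfolding Pk using ik \<sigma>.prob_space by simp
    also have "(\<integral>\<theta>. Re (k (\<i> * y) \<theta>) \<partial>\<sigma>) = Re (\<integral>\<theta>. k (\<i> * y) \<theta> \<partial>\<sigma>)"
      using k_int[OF z] by (rule integral_Re)
    also have "2 * m * Re (\<integral>\<theta>. k (\<i> * y) \<theta> \<partial>\<sigma>) - m = Re (\<i> * G (\<i> * y))"
      unfolding rep'[OF z] by (simp add: m_def)
    finally show "(\<integral>\<theta>. P y \<theta> \<partial>\<sigma>) = - y * Im (G (\<i> * y))" by simp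
  qed
  have P_nonneg: "P y \<theta> \<ge> 0" if "y > 0" for y \<theta>
    using Dpos[OF that, of \<theta>] m by (simp add: P_def)
  have limP: "(\<lambda>n. \<integral>\<theta>. P (real (Suc n)) \<theta> \<partial>\<sigma>) \<longlonglongrightarrow> 1"
  proof -
    have "((\<lambda>y. Re (\<i> * complex_of_real y * G (\<i> * complex_of_real y))) \<longlongrightarrow> Re 1) at_top"
      by (rule tendsto_Re[OF lim])
    then have "((\<lambda>y. - y * Im (G (\<i> * complex_of_real y))) \<longlongrightarrow> 1) at_top" by simp
    moreover have "filterlim (\<lambda>n. real (Suc n)) at_top sequentially"
      by (rule filterlim_compose[OF filterlim_real_sequentially filterlim_Suc])
    ultimately have "(\<lambda>n. - real (Suc n) * Im (G (\<i> * complex_of_real (real (Suc n))))) \<longlonglongrightarrow> 1"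
      by (rule filterlim_compose)
    then show ?thesis by (subst P(2)) auto
  qed
  have AE_S: "AE \<theta> in \<sigma>. S \<theta> \<noteq> 0"
  proof -
    define A where "A = {\<theta>. S \<theta> = 0}"
    have [measurable]: "A \<in> sets borel" unfolding A_def by measurable
    have "measure \<sigma> A \<le> (\<integral>\<theta>. P (real (Suc n)) \<theta> \<partial>\<sigma>) / m * inverse (real (Suc n))" for n
    proof -
      define y where "y = real (Suc n)"
      have y: "y \<ge> 1" by (simp add: y_def)
      have "m * y * measure \<sigma> A \<le> m * y\<^sup>2 * measure \<sigma> A"
        using m y by (intro mult_right_mono mult_left_mono) (auto simp: power2_eq_square)
      also have "\<dots> = (\<integral>\<theta>. m * y\<^sup>2 * indicator A \<theta> \<partial>\<sigma>)" by simp
      also have "\<dots> \<le> (\<integral>\<theta>. P y \<theta> \<partial>\<sigma>)"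
      proof (rule integral_mono)
        show "m * y\<^sup>2 * indicator A \<theta> \<le> P y \<theta>" for \<theta>
          using P_nonneg[of y \<theta>] y SC[of \<theta>] by (auto simp: indicator_def A_def P_def)
      qed (use y P(1)[of y] \<sigma>.emeasure_finite in \<open>auto simp: less_top[symmetric]\<close>)
      finally have "measure \<sigma> A \<le> (\<integral>\<theta>. P y \<theta> \<partial>\<sigma>) / m * inverse y"
        using m y by (simp add: field_simps)
      then show ?thesis unfolding y_def .
    qed
    moreover have "(\<lambda>n. (\<integral>\<theta>. P (real (Suc n)) \<theta> \<partial>\<sigma>) / m * inverse (real (Suc n))) \<longlonglongrightarrow> 1 / m * 0"
      using m by (intro tendsto_mult tendsto_divide limP LIMSEQ_inverse_real_of_nat tendsto_const) auto
    ultimately have "measure \<sigma> A \<le> 0"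
      by (intro LIMSEQ_le_const[of _ "1 / m * 0" "measure \<sigma> A", simplified]) auto
    then have "measure \<sigma> A = 0" by (simp add: measure_le_0_iff)
    then have "A \<in> null_sets \<sigma>" by (simp add: \<sigma>.emeasure_eq_measure null_sets_def)
    then show ?thesis by (rule AE_I'[of A]) (auto simp: A_def)
  qed

  define W where "W \<theta> = m / (S \<theta>)\<^sup>2" for \<theta>
  have [measurable]: "W \<in> borel_measurable borel" unfolding W_def by measurable
  have W_nonneg: "W \<theta> \<ge> 0" for \<theta> using m by (simp add: W_def)
  have W: "integrable \<sigma> W" "(\<integral>\<theta>. W \<theta> \<partial>\<sigma>) = 1"
  proof -
    have mono: "AE \<theta> in \<sigma>. mono (\<lambda>n. P (real (Suc n)) \<theta>)"
    proof (intro AE_I2 monoI)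
      fix \<theta> and n k :: nat assume "n \<le> k"
      define x y where "x = real (Suc n)" and "y = real (Suc k)"
      have xy: "0 < x" "x \<le> y" using \<open>n \<le> k\<close> by (auto simp: x_def y_def)
      have "x\<^sup>2 * ((C \<theta>)\<^sup>2 + y\<^sup>2 * (S \<theta>)\<^sup>2) \<le> y\<^sup>2 * ((C \<theta>)\<^sup>2 + x\<^sup>2 * (S \<theta>)\<^sup>2)"
        using mult_right_mono[OF power_mono[of x y 2], of "(C \<theta>)\<^sup>2"] xy by (simp add: algebra_simps)
      then have "m * (x\<^sup>2 * ((C \<theta>)\<^sup>2 + y\<^sup>2 * (S \<theta>)\<^sup>2)) \<le> m * (y\<^sup>2 * ((C \<theta>)\<^sup>2 + x\<^sup>2 * (S \<theta>)\<^sup>2))"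
        using m by (intro mult_left_mono) auto
      then show "P (real (Suc n)) \<theta> \<le> P (real (Suc k)) \<theta>"
        unfolding P_def x_def[symmetric] y_def[symmetric]
        using Dpos[of x \<theta>] Dpos[of y \<theta>] xy by (simp add: frac_le_eq divide_le_0_iff field_simps)
    qed
    have lim: "AE \<theta> in \<sigma>. (\<lambda>n. P (real (Suc n)) \<theta>) \<longlonglongrightarrow> W \<theta>"
      using AE_S
    proof eventually_elim
      case (elim \<theta>)
      have "(\<lambda>n. m / ((inverse (real (Suc n)))\<^sup>2 * (C \<theta>)\<^sup>2 + (S \<theta>)\<^sup>2)) \<longlonglongrightarrow> m / (0\<^sup>2 * (C \<theta>)\<^sup>2 + (S \<theta>)\<^sup>2)"
        using elim by (intro tendsto_intros LIMSEQ_inverse_real_of_nat) auto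
      moreover have "m / ((inverse (real (Suc n)))\<^sup>2 * (C \<theta>)\<^sup>2 + (S \<theta>)\<^sup>2) = P (real (Suc n)) \<theta>" for n
      proof -
        define y where "y = real (Suc n)"
        have y: "y > 0" by (simp add: y_def)
        have "(inverse y)\<^sup>2 * (C \<theta>)\<^sup>2 + (S \<theta>)\<^sup>2 = ((C \<theta>)\<^sup>2 + y\<^sup>2 * (S \<theta>)\<^sup>2) / y\<^sup>2"
          using y by (simp add: field_simps)
        then have "m / ((inverse y)\<^sup>2 * (C \<theta>)\<^sup>2 + (S \<theta>)\<^sup>2) = P y \<theta>" by (simp add: P_def)
        then show ?thesis unfolding y_def .
      qed
      ultimately show ?case by (simp add: W_def)
    qed
    have nn: "AE \<theta> in \<sigma>. 0 \<le> P (real (Suc n)) \<theta>" for n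
      using P_nonneg by auto
    have meas: "W \<in> borel_measurable \<sigma>" by measurable
    show "integrable \<sigma> W" "(\<integral>\<theta>. W \<theta> \<partial>\<sigma>) = 1"
      using integral_monotone_convergence_nonneg[OF P(1) mono nn lim limP meas] by auto
  qed

  define X where "X \<theta> = - C \<theta> / S \<theta>" for \<theta>
  have [measurable]: "X \<in> borel_measurable borel" unfolding X_def by measurable
  define \<nu> where "\<nu> = distr (density \<sigma> (\<lambda>\<theta>. ennreal (W \<theta>))) borel X"
  have rd_\<nu>: "real_distribution \<nu>"
  proof -
    have "prob_space (density \<sigma> (\<lambda>\<theta>. ennreal (W \<theta>)))"
      using W W_nonneg by (intro prob_spaceI) (simp add: emeasure_density nn_integral_eq_integral)
    then have "prob_space \<nu>" unfolding \<nu>_def by (rule prob_space.prob_space_distr) simp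
    then show ?thesis by (simp add: real_distribution_def real_distribution_axioms_def \<nu>_def)
  qed
  interpret \<nu>: real_distribution \<nu> by (rule rd_\<nu>)
  define c where "c = (\<integral>\<theta>. \<i> * m * (X \<theta> - \<i>) \<partial>\<sigma>) - cnj (p 0)"
  have decomp: "\<i> * G z = \<i> * (\<integral>x. 1 / (z - complex_of_real x) \<partial>\<nu>) + c" if z: "Im z > 0" for z
  proof -
    define r where "r x = 1 / (z - complex_of_real x)" for x
    have [measurable]: "r \<in> borel_measurable borel" unfolding r_def by measurable
    have int_r: "(\<integral>x. r x \<partial>\<nu>) = (\<integral>\<theta>. W \<theta> *\<^sub>R r (X \<theta>) \<partial>\<sigma>)"
      unfolding \<nu>_def using W_nonneg by (subst integral_distr) (auto simp: integral_density)
    have i1: "integrable \<sigma> (\<lambda>\<theta>. \<i> * (W \<theta> *\<^sub>R r (X \<theta>)))"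
    proof -
      have "integrable \<nu> r" unfolding r_def by (rule \<nu>.integrable_resolvent[OF z])
      then have "integrable \<sigma> (\<lambda>\<theta>. W \<theta> *\<^sub>R r (X \<theta>))"
        unfolding \<nu>_def using W_nonneg by (simp add: integrable_distr_eq integrable_density)
      then show ?thesis by (intro integrable_mult_right)
    qed
    have i2: "integrable \<sigma> (\<lambda>\<theta>. 2 * m * k z \<theta> - \<i> * (W \<theta> *\<^sub>R r (X \<theta>)))"
      using k_int[OF z] i1 by simp
    \<comment> \<open>The partial fraction \<open>(z + \<i>)(\<i> - x) / (z - x) = - (1 + x\<^sup>2) / (z - x) - (x - \<i>)\<close>: what remains does not depend on \<open>z\<close>.\<close>
    have kr: "2 * m * k z \<theta> - \<i> * (W \<theta> *\<^sub>R r (X \<theta>)) = \<i> * m * (X \<theta> - \<i>)" if S: "S \<theta> \<noteq> 0" for \<theta>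
    proof -
      have zx: "z - complex_of_real (X \<theta>) \<noteq> 0" using z by (auto simp: complex_eq_iff)
      have e1: "z * S \<theta> + C \<theta> = S \<theta> * (z - X \<theta>)" using S by (simp add: X_def field_simps)
      have e2: "cis (pi * \<theta>) = S \<theta> * (\<i> - X \<theta>)"
        using S by (simp add: X_def complex_eq_iff) (simp add: S_def C_def)
      have "1 + (X \<theta>)\<^sup>2 = ((C \<theta>)\<^sup>2 + (S \<theta>)\<^sup>2) / (S \<theta>)\<^sup>2"
        using S by (simp add: X_def field_simps)
      then have e3: "W \<theta> = m * (1 + (X \<theta>)\<^sup>2)" by (simp add: W_def SC)
      have "k z \<theta> = (z + \<i>) * (\<i> - X \<theta>) / (2 * \<i> * (z - X \<theta>))"
        unfolding k_def e1 e2 using S by simp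
      then have "2 * m * k z \<theta> = m * ((z + \<i>) * (\<i> - X \<theta>)) / (\<i> * (z - X \<theta>))" by simp
      also have "\<dots> = - \<i> * m * ((z + \<i>) * (\<i> - X \<theta>)) / (z - X \<theta>)"
        using zx by (simp add: field_simps)
      finally have "2 * m * k z \<theta> - \<i> * (W \<theta> *\<^sub>R r (X \<theta>)) =
         (- \<i> * m * ((z + \<i>) * (\<i> - X \<theta>)) - \<i> * m * (1 + (X \<theta>)\<^sup>2)) / (z - X \<theta>)"
        unfolding e3 r_def by (simp add: scaleR_conv_of_real diff_divide_distrib)
      also have "(- \<i> * m * ((z + \<i>) * (\<i> - X \<theta>)) - \<i> * m * (1 + (X \<theta>)\<^sup>2)) = \<i> * m * (X \<theta> - \<i>) * (z - X \<theta>)"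
        by (simp add: algebra_simps power2_eq_square)
      finally show ?thesis using zx by simp
    qed
    have "(\<integral>\<theta>. 2 * m * k z \<theta> \<partial>\<sigma>) = (\<integral>\<theta>. \<i> * (W \<theta> *\<^sub>R r (X \<theta>)) + (2 * m * k z \<theta> - \<i> * (W \<theta> *\<^sub>R r (X \<theta>))) \<partial>\<sigma>)"
      by simp
    also have "\<dots> = (\<integral>\<theta>. \<i> * (W \<theta> *\<^sub>R r (X \<theta>)) \<partial>\<sigma>) + (\<integral>\<theta>. 2 * m * k z \<theta> - \<i> * (W \<theta> *\<^sub>R r (X \<theta>)) \<partial>\<sigma>)"
      using i1 i2 by (rule Bochner_Integration.integral_add)
    also have "(\<integral>\<theta>. 2 * m * k z \<theta> - \<i> * (W \<theta> *\<^sub>R r (X \<theta>)) \<partial>\<sigma>) = (\<integral>\<theta>. \<i> * m * (X \<theta> - \<i>) \<partial>\<sigma>)"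
    proof (rule integral_cong_AE)
      show "AE \<theta> in \<sigma>. 2 * m * k z \<theta> - \<i> * (W \<theta> *\<^sub>R r (X \<theta>)) = \<i> * m * (X \<theta> - \<i>)"
        by (rule eventually_mono[OF AE_S]) (rule kr)
    qed (use i2 in auto)
    also have "(\<integral>\<theta>. \<i> * (W \<theta> *\<^sub>R r (X \<theta>)) \<partial>\<sigma>) = \<i> * (\<integral>\<theta>. W \<theta> *\<^sub>R r (X \<theta>) \<partial>\<sigma>)"
      by (rule integral_mult_right_zero)
    finally show ?thesis
      unfolding rep'[OF z] c_def r_def[symmetric] int_r by simp
  qed
  have "c = 0"
  proof -
    have "((\<lambda>y. \<i> * complex_of_real y * G (\<i> * complex_of_real y) * inverse (\<i> * complex_of_real y)) \<longlongrightarrow> 1 * 0) at_top"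
    proof (rule tendsto_mult[OF lim])
      have "((\<lambda>y. - \<i> * complex_of_real (inverse y)) \<longlongrightarrow> - \<i> * complex_of_real 0) at_top"
        by (intro tendsto_intros tendsto_inverse_0_at_top filterlim_ident)
      then show "((\<lambda>y. inverse (\<i> * complex_of_real y)) \<longlongrightarrow> 0) at_top" by simp
    qed
    then have G0: "((\<lambda>y. G (\<i> * complex_of_real y)) \<longlongrightarrow> 0) at_top"
    proof (rule Lim_transform_eventually[OF tendsto_eq_rhs])
      show "\<forall>\<^sub>F y in at_top. \<i> * complex_of_real y * G (\<i> * complex_of_real y) * inverse (\<i> * complex_of_real y)
          = G (\<i> * complex_of_real y)"
        by (rule eventually_mono[OF eventually_gt_at_top[of 0]]) (simp add: field_simps)
    qed simp
    have I0: "((\<lambda>y. \<integral>x. 1 / (\<i> * complex_of_real y - complex_of_real x) \<partial>\<nu>) \<longlongrightarrow> 0) at_top"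
    proof (rule Lim_null_comparison)
      show "((\<lambda>y::real. inverse y) \<longlongrightarrow> 0) at_top"
        by (intro tendsto_inverse_0_at_top filterlim_ident)
      show "\<forall>\<^sub>F y in at_top. norm (\<integral>x. 1 / (\<i> * complex_of_real y - complex_of_real x) \<partial>\<nu>) \<le> inverse y"
      proof (rule eventually_mono[OF eventually_gt_at_top[of 0]])
        fix y :: real assume y: "y > 0"
        have "norm (\<integral>x. 1 / (\<i> * complex_of_real y - complex_of_real x) \<partial>\<nu>)
           \<le> (\<integral>x. norm (1 / (\<i> * complex_of_real y - complex_of_real x)) \<partial>\<nu>)" by simp
        also have "\<dots> \<le> (\<integral>x. 1 / y \<partial>\<nu>)"
          using \<nu>.integrable_resolvent[of "\<i> * complex_of_real y"] y
            norm_resolvent_le[of y "\<i> * complex_of_real y"]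
          by (intro integral_mono) auto
        finally show "norm (\<integral>x. 1 / (\<i> * complex_of_real y - complex_of_real x) \<partial>\<nu>) \<le> inverse y"
          using \<nu>.prob_space by (simp add: divide_inverse)
      qed
    qed
    have "((\<lambda>y. \<i> * G (\<i> * complex_of_real y) - \<i> * (\<integral>x. 1 / (\<i> * complex_of_real y - complex_of_real x) \<partial>\<nu>)) \<longlongrightarrow> \<i> * 0 - \<i> * 0) at_top"
      by (intro tendsto_intros G0 I0)
    moreover have "\<forall>\<^sub>F y in at_top. \<i> * G (\<i> * complex_of_real y) - \<i> * (\<integral>x. 1 / (\<i> * complex_of_real y - complex_of_real x) \<partial>\<nu>) = c"
      by (rule eventually_mono[OF eventually_gt_at_top[of 0]]) (subst decomp, auto)
    ultimately have "((\<lambda>y::real. c) \<longlongrightarrow> 0) at_top"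
      using Lim_transform_eventually by fastforce
    then show ?thesis by (simp add: tendsto_const_iff)
  qed
  then show ?thesis using decomp rd_\<nu> by (intro exI[of _ \<nu>]) auto
qed

section \<open>The Loewner vector field\<close>

lemma norm_resolvent_diff_le:
  assumes d: "0 < d" "d \<le> Im y" "d \<le> Im z"
  shows "norm (1 / (y - complex_of_real x) - 1 / (z - complex_of_real x)) \<le> norm (y - z) / d\<^sup>2"
proof -
  have nz: "y - complex_of_real x \<noteq> 0" "z - complex_of_real x \<noteq> 0" using d by (auto simp: complex_eq_iff)
  have "1 / (y - complex_of_real x) - 1 / (z - complex_of_real x)
      = - (y - z) * (1 / (y - complex_of_real x) * (1 / (z - complex_of_real x)))"
    using nz by (simp add: field_simps)
  then have "norm (1 / (y - complex_of_real x) - 1 / (z - complex_of_real x))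
      = norm (y - z) * (norm (1 / (y - complex_of_real x)) * norm (1 / (z - complex_of_real x)))"
    by (simp only: norm_mult norm_minus_cancel)
  also have "\<dots> \<le> norm (y - z) * (1 / d * (1 / d))"
    using norm_resolvent_le[OF d(1,2), of x] norm_resolvent_le[OF d(1,3), of x] d(1)
    by (intro mult_left_mono mult_mono) auto
  finally show ?thesis by (simp add: power2_eq_square)
qed

text \<open>The consequences of membership in the space of driving paths that the flow depends on: finiteness,
  a uniform bound for the masses, and weak continuity in time.\<close>

locale bounded_measure_path =
  fixes \<mu> :: "real \<Rightarrow> real measure" and B :: real
  assumes finite_borel: "\<And>t. 0 \<le> t \<Longrightarrow> finite_borel_measure (\<mu> t)"
    and mass_le: "\<And>t. 0 \<le> t \<Longrightarrow> measure (\<mu> t) UNIV \<le> B"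
    and weakly_continuous: "\<And>\<phi> :: real \<Rightarrow> real. continuous_on UNIV \<phi> \<Longrightarrow> bounded (range \<phi>) \<Longrightarrow>
          continuous_on {0..} (\<lambda>t. \<integral>x. \<phi> x \<partial>\<mu> t)"
begin

lemma B_nonneg: "0 \<le> B"
  using mass_le[of 0] measure_nonneg[of "\<mu> 0" UNIV] by linarith

lemma integrable_bounded_continuous:
  fixes \<phi> :: "real \<Rightarrow> 'a :: {banach, second_countable_topology}"
  assumes t: "0 \<le> t" and c: "continuous_on UNIV \<phi>" and b: "\<And>x. norm (\<phi> x) \<le> K"
  shows "integrable (\<mu> t) \<phi>" "norm (\<integral>x. \<phi> x \<partial>\<mu> t) \<le> K * B"
proof -
  interpret finite_borel_measure "\<mu> t" by (rule finite_borel[OF t])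
  have sp: "space (\<mu> t) = UNIV" using sets_eq_imp_space_eq[OF M_is_borel] by simp
  have "\<phi> \<in> borel_measurable (\<mu> t)"
    using borel_measurable_continuous_onI[OF c] by (simp cong: measurable_cong_sets add: M_is_borel)
  then show i: "integrable (\<mu> t) \<phi>"
    using b by (intro integrable_const_bound[where B = K]) auto
  have "norm (\<integral>x. \<phi> x \<partial>\<mu> t) \<le> (\<integral>x. norm (\<phi> x) \<partial>\<mu> t)" by simp
  also have "\<dots> \<le> (\<integral>x. K \<partial>\<mu> t)"
    using i b by (intro integral_mono) auto
  also have "\<dots> = K * measure (\<mu> t) UNIV" by (simp add: sp)
  also have "\<dots> \<le> K * B"
    using mass_le[OF t] order_trans[OF norm_ge_zero b] by (intro mult_left_mono) auto
  finally show "norm (\<integral>x. \<phi> x \<partial>\<mu> t) \<le> K * B" .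
qed

lemma weakly_continuous_complex:
  fixes \<phi> :: "real \<Rightarrow> complex"
  assumes c: "continuous_on UNIV \<phi>" and b: "\<And>x. norm (\<phi> x) \<le> K"
  shows "continuous_on {0..} (\<lambda>t. \<integral>x. \<phi> x \<partial>\<mu> t)"
proof -
  have "(\<integral>x. \<phi> x \<partial>\<mu> t) = Complex (\<integral>x. Re (\<phi> x) \<partial>\<mu> t) (\<integral>x. Im (\<phi> x) \<partial>\<mu> t)" if "0 \<le> t" for t
    using integrable_bounded_continuous(1)[OF that c b] by (simp add: complex_eq_iff)
  moreover have "continuous_on {0..} (\<lambda>t. Complex (\<integral>x. Re (\<phi> x) \<partial>\<mu> t) (\<integral>x. Im (\<phi> x) \<partial>\<mu> t))"
  proof (intro continuous_on_Complex weakly_continuous)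
    have "\<bar>Re (\<phi> x)\<bar> \<le> K" "\<bar>Im (\<phi> x)\<bar> \<le> K" for x
      using abs_Re_le_cmod[of "\<phi> x"] abs_Im_le_cmod[of "\<phi> x"] b[of x] by auto
    then show "bounded (range (\<lambda>x. Re (\<phi> x)))" "bounded (range (\<lambda>x. Im (\<phi> x)))"
      by (auto simp: bounded_iff intro!: exI[of _ K])
  qed (auto intro!: continuous_intros c)
  ultimately show ?thesis by (subst continuous_on_cong[OF refl]) auto
qed

text \<open>Weak continuity extends to integrands that move continuously in the supremum norm, because the masses
  are bounded.\<close>

lemma continuous_on_integral_moving:
  fixes \<Psi> :: "real \<Rightarrow> real \<Rightarrow> complex"
  assumes S: "S \<subseteq> {0..}"
    and c: "\<And>s. s \<in> S \<Longrightarrow> continuous_on UNIV (\<Psi> s)"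
    and b: "\<And>s x. s \<in> S \<Longrightarrow> norm (\<Psi> s x) \<le> K"
    and unif: "\<And>s0. s0 \<in> S \<Longrightarrow> uniform_limit UNIV \<Psi> (\<Psi> s0) (at s0 within S)"
  shows "continuous_on S (\<lambda>s. \<integral>x. \<Psi> s x \<partial>\<mu> s)"
  unfolding continuous_on_def
proof (intro ballI)
  fix s0 assume s0: "s0 \<in> S"
  have l: "((\<lambda>s. \<integral>x. \<Psi> s0 x \<partial>\<mu> s) \<longlongrightarrow> (\<integral>x. \<Psi> s0 x \<partial>\<mu> s0)) (at s0 within S)"
    using continuous_on_subset[OF weakly_continuous_complex[OF c[OF s0] b[OF s0]] S] s0
    by (simp add: continuous_on_def)
  have d: "((\<lambda>s. (\<integral>x. \<Psi> s x \<partial>\<mu> s) - (\<integral>x. \<Psi> s0 x \<partial>\<mu> s)) \<longlongrightarrow> 0) (at s0 within S)"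
  proof (rule tendstoI)
    fix e :: real assume e: "e > 0"
    define e' where "e' = e / (B + 1)"
    have e': "e' > 0" "e' * B < e" using e B_nonneg by (auto simp: e'_def field_simps)
    have "\<forall>\<^sub>F s in at s0 within S. \<forall>x\<in>UNIV. dist (\<Psi> s x) (\<Psi> s0 x) < e'"
      using uniform_limitD[OF unif[OF s0] e'(1)] .
    moreover have "\<forall>\<^sub>F s in at s0 within S. s \<in> S" by (auto simp: eventually_at_filter)
    ultimately show "\<forall>\<^sub>F s in at s0 within S. dist ((\<integral>x. \<Psi> s x \<partial>\<mu> s) - (\<integral>x. \<Psi> s0 x \<partial>\<mu> s)) 0 < e"
    proof eventually_elim
      case (elim s)
      then have s: "s \<in> S" "0 \<le> s" using S by auto
      have "(\<integral>x. \<Psi> s x \<partial>\<mu> s) - (\<integral>x. \<Psi> s0 x \<partial>\<mu> s) = (\<integral>x. \<Psi> s x - \<Psi> s0 x \<partial>\<mu> s)"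
        using integrable_bounded_continuous(1)[OF s(2) c b] s s0
        by (intro Bochner_Integration.integral_diff[symmetric]) blast+
      also have "norm \<dots> \<le> e' * B"
        using elim(1) by (intro integrable_bounded_continuous(2)[OF s(2)] continuous_on_diff c s s0)
          (auto simp: dist_norm less_imp_le)
      finally show ?case using e' by simp
    qed
  qed
  from tendsto_add[OF d l] show "((\<lambda>s. \<integral>x. \<Psi> s x \<partial>\<mu> s) \<longlongrightarrow> (\<integral>x. \<Psi> s0 x \<partial>\<mu> s0)) (at s0 within S)"
    by simp
qed

definition drift :: "real \<Rightarrow> complex \<Rightarrow> complex" where
  "drift t z = (\<integral>x. 1 / (z - complex_of_real x) \<partial>\<mu> t)"

lemma continuous_resolvent: "Im z > 0 \<Longrightarrow> continuous_on UNIV (\<lambda>x. 1 / (z - complex_of_real x))"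
  by (intro continuous_intros) (auto simp: complex_eq_iff)

lemma integrable_resolvent_path: "0 \<le> t \<Longrightarrow> Im z > 0 \<Longrightarrow> integrable (\<mu> t) (\<lambda>x. 1 / (z - complex_of_real x))"
  using finite_borel_measure.integrable_resolvent[OF finite_borel] .

lemma norm_drift_le:
  assumes "0 \<le> t" "0 < d" "d \<le> Im z"
  shows "norm (drift t z) \<le> B / d"
  using integrable_bounded_continuous(2)[OF assms(1) continuous_resolvent norm_resolvent_le[OF assms(2,3)]] assms
  unfolding drift_def by simp

lemma Im_drift_nonpos:
  assumes "0 \<le> t" "0 < Im z"
  shows "Im (drift t z) \<le> 0"
proof -
  have "Im (drift t z) = (\<integral>x. Im (1 / (z - complex_of_real x)) \<partial>\<mu> t)"
    unfolding drift_def by (rule integral_Im[OF integrable_resolvent_path[OF assms], symmetric])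
  also have "\<dots> = - (\<integral>x. - Im (1 / (z - complex_of_real x)) \<partial>\<mu> t)" by simp
  moreover have "(\<integral>x. - Im (1 / (z - complex_of_real x)) \<partial>\<mu> t) \<ge> 0"
    using assms by (intro Bochner_Integration.integral_nonneg) (simp add: Im_divide)
  ultimately show ?thesis by linarith
qed

lemma drift_lipschitz:
  assumes t: "0 \<le> t" and d: "0 < d" "d \<le> Im y" "d \<le> Im z"
  shows "norm (drift t y - drift t z) \<le> B / d\<^sup>2 * norm (y - z)"
proof -
  have y: "0 < Im y" "0 < Im z" using d by auto
  have "drift t y - drift t z = (\<integral>x. 1 / (y - complex_of_real x) - 1 / (z - complex_of_real x) \<partial>\<mu> t)"
    unfolding drift_def using y t by (intro Bochner_Integration.integral_diff[symmetric] integrable_resolvent_path)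
  also have "norm \<dots> \<le> norm (y - z) / d\<^sup>2 * B"
    using norm_resolvent_diff_le[OF d]
    by (intro integrable_bounded_continuous(2)[OF t] continuous_on_diff continuous_resolvent y) auto
  finally show ?thesis by (simp add: mult.commute)
qed

lemma drift_continuous_time:
  assumes "0 < Im z"
  shows "continuous_on {0..} (\<lambda>t. drift t z)"
  unfolding drift_def by (rule weakly_continuous_complex[OF continuous_resolvent[OF assms] norm_resolvent_le[OF assms order_refl]])

lemma uniform_limit_resolvent:
  assumes a: "continuous_on S a" and d: "0 < d" "\<And>s. s \<in> S \<Longrightarrow> d \<le> Im (a s)" and s0: "s0 \<in> S"
  shows "uniform_limit UNIV (\<lambda>s x. 1 / (a s - complex_of_real x)) (\<lambda>x. 1 / (a s0 - complex_of_real x)) (at s0 within S)"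
proof (rule uniform_limitI)
  fix e :: real assume e: "e > 0"
  have "(a \<longlongrightarrow> a s0) (at s0 within S)" using a s0 by (simp add: continuous_on_def)
  then have "\<forall>\<^sub>F s in at s0 within S. dist (a s) (a s0) < e * d\<^sup>2"
    by (rule tendstoD) (use e d in simp)
  moreover have "\<forall>\<^sub>F s in at s0 within S. s \<in> S" by (auto simp: eventually_at_filter)
  ultimately show "\<forall>\<^sub>F s in at s0 within S. \<forall>x\<in>UNIV.
      dist (1 / (a s - complex_of_real x)) (1 / (a s0 - complex_of_real x)) < e"
  proof eventually_elim
    case (elim s)
    then have "norm (a s - a s0) / d\<^sup>2 < e" using d by (simp add: dist_norm pos_divide_less_eq)
    then show ?case
      using norm_resolvent_diff_le[OF d(1) d(2)[OF elim(2)] d(2)[OF s0]]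
      unfolding dist_norm by (blast intro: le_less_trans)
  qed
qed

text \<open>Minus the divided difference of the field along two curves: the field differs between \<open>a s\<close> and \<open>b s\<close> by
  \<open>- (a s - b s)\<close> times this quantity, by the resolvent identity.\<close>

definition resolvent_product :: "(real \<Rightarrow> complex) \<Rightarrow> (real \<Rightarrow> complex) \<Rightarrow> real \<Rightarrow> complex" where
  "resolvent_product a b s = (\<integral>x. 1 / (a s - complex_of_real x) * (1 / (b s - complex_of_real x)) \<partial>\<mu> s)"

lemma norm_resolvent_product_integrand_le:
  assumes "0 < d" "d \<le> Im y" "0 < e" "e \<le> Im z"
  shows "norm (1 / (y - complex_of_real x) * (1 / (z - complex_of_real x))) \<le> 1 / d * (1 / e)"
  unfolding norm_mult using assms
  by (intro mult_mono norm_resolvent_le) auto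

lemma norm_resolvent_product_le:
  assumes "0 \<le> s" "0 < d" "d \<le> Im (a s)" "0 < e" "e \<le> Im (b s)"
  shows "norm (resolvent_product a b s) \<le> B / (d * e)"
  using integrable_bounded_continuous(2)[OF assms(1) continuous_on_mult[OF continuous_resolvent continuous_resolvent]
      norm_resolvent_product_integrand_le[OF assms(2-5)]] assms(2-5)
  unfolding resolvent_product_def by simp

lemma continuous_on_resolvent_product:
  assumes S: "S \<subseteq> {0..}" and a: "continuous_on S a" and b: "continuous_on S b"
    and d: "0 < d" "\<And>s. s \<in> S \<Longrightarrow> d \<le> Im (a s)" "\<And>s. s \<in> S \<Longrightarrow> d \<le> Im (b s)"
  shows "continuous_on S (resolvent_product a b)"
  unfolding resolvent_product_def
proof (rule continuous_on_integral_moving[OF S])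
  have im: "0 < Im (a s)" "0 < Im (b s)" if "s \<in> S" for s using d(2,3)[OF that] d(1) by auto
  show "continuous_on UNIV (\<lambda>x. 1 / (a s - complex_of_real x) * (1 / (b s - complex_of_real x)))" if "s \<in> S" for s
    by (intro continuous_on_mult continuous_resolvent im that)
  show "norm (1 / (a s - complex_of_real x) * (1 / (b s - complex_of_real x))) \<le> 1 / d * (1 / d)" if "s \<in> S" for s x
    using norm_resolvent_product_integrand_le[OF d(1) d(2)[OF that] d(1) d(3)[OF that]] .
  show "uniform_limit UNIV (\<lambda>s x. 1 / (a s - complex_of_real x) * (1 / (b s - complex_of_real x)))
     (\<lambda>x. 1 / (a s0 - complex_of_real x) * (1 / (b s0 - complex_of_real x))) (at s0 within S)" if s0: "s0 \<in> S" for s0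
  proof (rule uniform_lim_mult)
    show "uniform_limit UNIV (\<lambda>s x. 1 / (a s - complex_of_real x)) (\<lambda>x. 1 / (a s0 - complex_of_real x)) (at s0 within S)"
      "uniform_limit UNIV (\<lambda>s x. 1 / (b s - complex_of_real x)) (\<lambda>x. 1 / (b s0 - complex_of_real x)) (at s0 within S)"
      using uniform_limit_resolvent[OF a d(1,2) s0] uniform_limit_resolvent[OF b d(1,3) s0] by auto
    show "bounded ((\<lambda>x. 1 / (a s0 - complex_of_real x)) ` UNIV)" "bounded ((\<lambda>x. 1 / (b s0 - complex_of_real x)) ` UNIV)"
      unfolding bounded_iff using norm_resolvent_le[OF d(1) d(2)[OF s0]] norm_resolvent_le[OF d(1) d(3)[OF s0]] by blast+
  qed
qed

lemma drift_diff:
  assumes "0 \<le> s" "0 < Im (a s)" "0 < Im (b s)"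
  shows "drift s (a s) - drift s (b s) = - (a s - b s) * resolvent_product a b s"
proof -
  have nz: "a s - complex_of_real x \<noteq> 0" "b s - complex_of_real x \<noteq> 0" for x
    using assms by (auto simp: complex_eq_iff)
  have "drift s (a s) - drift s (b s) = (\<integral>x. 1 / (a s - complex_of_real x) - 1 / (b s - complex_of_real x) \<partial>\<mu> s)"
    unfolding drift_def using assms by (intro Bochner_Integration.integral_diff[symmetric] integrable_resolvent_path)
  also have "\<dots> = (\<integral>x. - (a s - b s) * (1 / (a s - complex_of_real x) * (1 / (b s - complex_of_real x))) \<partial>\<mu> s)"
    using nz by (intro Bochner_Integration.integral_cong refl) (simp add: field_simps)
  also have "\<dots> = - (a s - b s) * resolvent_product a b s"
    unfolding resolvent_product_def by (rule integral_mult_right_zero)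
  finally show ?thesis .
qed

section \<open>Trajectories of the Loewner flow\<close>

definition trajectory :: "real \<Rightarrow> (real \<Rightarrow> complex) \<Rightarrow> bool" where
  "trajectory t a \<longleftrightarrow> (\<forall>s\<in>{0..t}. 0 < Im (a s) \<and> (a has_vector_derivative drift s (a s)) (at s within {0..t}))"

lemma trajectory_continuous: "trajectory t a \<Longrightarrow> continuous_on {0..t} a"
  unfolding trajectory_def continuous_on_eq_continuous_within
  using has_vector_derivative_continuous by blast

text \<open>The field points downwards. Hence the endpoint of a trajectory bounds its distance to the real line
  from below at all earlier times, which makes all estimates on \<open>[0, t]\<close> depend on the endpoint only.\<close>

lemma trajectory_Im_antimono:
  assumes tr: "trajectory t a" and s: "0 \<le> s" "s \<le> t"
  shows "Im (a t) \<le> Im (a s)"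
proof (rule DERIV_nonpos_imp_decreasing_open[OF s(2), of "\<lambda>r. Im (a r)"])
  show "continuous_on {s..t} (\<lambda>r. Im (a r))"
    using continuous_on_subset[OF trajectory_continuous[OF tr], of "{s..t}"] s
    by (auto intro!: continuous_intros)
  fix r assume r: "s < r" "r < t"
  have d: "(a has_vector_derivative drift r (a r)) (at r within {0..t})" "0 < Im (a r)"
    using tr r s by (auto simp: trajectory_def)
  have "(a has_vector_derivative drift r (a r)) (at r)"
    using d(1) r s at_within_Icc_at[of 0 r t] by simp
  then have "((\<lambda>r. Im (a r)) has_vector_derivative Im (drift r (a r))) (at r)"
    by (rule bounded_linear.has_vector_derivative[OF bounded_linear_Im])
  then show "\<exists>y. ((\<lambda>r. Im (a r)) has_real_derivative y) (at r) \<and> y \<le> 0"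
    using Im_drift_nonpos[of r "a r"] d(2) r s
    by (auto simp: has_real_derivative_iff_has_vector_derivative)
qed

text \<open>By the resolvent identity the difference of two trajectories solves a linear scalar equation with
  coefficient \<open>- resolvent_product a b\<close>, which is solved by an exponential.\<close>

theorem trajectory_difference:
  assumes a: "trajectory t a" and b: "trajectory t b" and s: "0 \<le> s" "s \<le> t"
  shows "a s - b s = (a t - b t) * exp (integral {s..t} (resolvent_product a b))"
proof -
  let ?K = "resolvent_product a b"
  define d where "d = min (Im (a t)) (Im (b t))"
  have d: "d > 0" using a b s by (auto simp: d_def trajectory_def)
  have cK: "continuous_on {s..t} ?K"
  proof (rule continuous_on_resolvent_product[OF _ _ _ d])
    show "{s..t} \<subseteq> {0..}" using s by auto
    show "continuous_on {s..t} a" "continuous_on {s..t} b"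
      using trajectory_continuous[OF a] trajectory_continuous[OF b] s by (auto elim!: continuous_on_subset)
    show "d \<le> Im (a r)" "d \<le> Im (b r)" if "r \<in> {s..t}" for r
      using trajectory_Im_antimono[OF a, of r] trajectory_Im_antimono[OF b, of r] that s by (auto simp: d_def)
  qed
  define F where "F r = (a r - b r) * exp (integral {s..r} ?K)" for r
  have "(F has_vector_derivative 0) (at r within {s..t})" if r: "r \<in> {s..t}" for r
  proof -
    have dr: "(a has_vector_derivative drift r (a r)) (at r within {s..t})" "(b has_vector_derivative drift r (b r)) (at r within {s..t})"
      using a b r s unfolding trajectory_def
      by (auto intro!: has_vector_derivative_within_subset[of _ _ r "{0..t}" "{s..t}"])
    have r0: "0 \<le> r" using r s by simp
    have im: "0 < Im (a r)" "0 < Im (b r)" using a b r s by (auto simp: trajectory_def)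
    have i: "((\<lambda>r. integral {s..r} ?K) has_vector_derivative ?K r) (at r within {s..t})"
      by (rule integral_has_vector_derivative[OF cK r])
    have e: "((\<lambda>r. exp (integral {s..r} ?K)) has_vector_derivative ?K r * exp (integral {s..r} ?K)) (at r within {s..t})"
      using field_vector_diff_chain_within[OF i, of exp "exp (integral {s..r} ?K)"]
      by (simp add: o_def DERIV_exp has_field_derivative_at_within)
    have "(F has_vector_derivative ((a r - b r) * (?K r * exp (integral {s..r} ?K)) + (drift r (a r) - drift r (b r)) * exp (integral {s..r} ?K)))
        (at r within {s..t})"
      unfolding F_def by (rule has_vector_derivative_mult[OF has_vector_derivative_diff[OF dr] e])
    moreover have "(a r - b r) * (?K r * exp (integral {s..r} ?K)) + (drift r (a r) - drift r (b r)) * exp (integral {s..r} ?K) = 0"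
      unfolding drift_diff[of r a b, OF r0 im] by (simp add: algebra_simps)
    ultimately show ?thesis by simp
  qed
  then obtain c where c: "\<And>r. r \<in> {s..t} \<Longrightarrow> F r = c"
    using has_vector_derivative_zero_constant[of "{s..t}" F] by auto
  have "F s = F t" using c[of s] c[of t] s by simp
  then show ?thesis by (simp add: F_def)
qed

text \<open>To apply the global existence result, the field is frozen below the height \<open>d = Im w / 2\<close>, by
  first lifting points to that height; this makes it Lipschitz. The modified field still points downwards,
  so its solution has height at least \<open>Im w\<close> before time \<open>t\<close>, and by continuity stays above \<open>d\<close> for a short while
  after \<open>t\<close>; there it solves the original equation. Reaching strictly beyond \<open>t\<close> shows that the existence
  time of the starting point exceeds \<open>t\<close>.\<close>

lemma solution_through_point:
  assumes t: "0 \<le> t" and w: "0 < Im w"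
  obtains \<gamma> T where "t < T" "\<gamma> t = w" "loewner_solution \<mu> (\<gamma> 0) (ereal T) \<gamma>"
proof -
  define d where "d = Im w / 2"
  have d: "d > 0" using w by (simp add: d_def)
  define lift where "lift z = Complex (Re z) (max d (Im z))" for z
  have lift_Im: "d \<le> Im (lift z)" for z by (simp add: lift_def)
  have lift_id: "lift z = z" if "d \<le> Im z" for z using that by (simp add: lift_def complex_eq_iff)
  have lift_lip: "norm (lift y - lift z) \<le> norm (y - z)" for y z
  proof (rule power2_le_imp_le)
    have "\<bar>max d (Im y) - max d (Im z)\<bar> \<le> \<bar>Im y - Im z\<bar>" by linarith
    then have "(max d (Im y) - max d (Im z))\<^sup>2 \<le> (Im y - Im z)\<^sup>2" by (simp only: abs_le_square_iff)
    then show "(norm (lift y - lift z))\<^sup>2 \<le> (norm (y - z))\<^sup>2"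
      unfolding cmod_power2 by (simp add: lift_def)
  qed simp
  have "\<exists>\<gamma>. \<gamma> t = w \<and> (\<forall>s\<in>{0..t+1}. (\<gamma> has_vector_derivative drift s (lift (\<gamma> s))) (at s within {0..t+1}))"
  proof (rule picard_lindelof_on_interval)
    show "continuous_on {0..t+1} (\<lambda>s. drift s (lift z))" for z
      by (rule continuous_on_subset[OF drift_continuous_time]) (use d lift_Im[of z] in auto)
    show "norm (drift s (lift y) - drift s (lift z)) \<le> B / d\<^sup>2 * norm (y - z)" if "s \<in> {0..t+1}" for s y z
      using drift_lipschitz[OF _ d lift_Im lift_Im, of s y z] that
        mult_left_mono[OF lift_lip[of y z], of "B / d\<^sup>2"] B_nonneg by fastforce
  qed (use t in simp)
  then obtain \<gamma> where \<gamma>t: "\<gamma> t = w"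
    and \<gamma>: "\<And>s. s \<in> {0..t+1} \<Longrightarrow> (\<gamma> has_vector_derivative drift s (lift (\<gamma> s))) (at s within {0..t+1})"
    by blast
  have cont: "continuous_on {0..t+1} \<gamma>"
    unfolding continuous_on_eq_continuous_within using \<gamma> has_vector_derivative_continuous by blast
  have anti: "Im (\<gamma> t) \<le> Im (\<gamma> s)" if s: "0 \<le> s" "s \<le> t" for s
  proof (rule DERIV_nonpos_imp_decreasing_open[OF s(2), of "\<lambda>r. Im (\<gamma> r)"])
    show "continuous_on {s..t} (\<lambda>r. Im (\<gamma> r))"
      using continuous_on_subset[OF cont, of "{s..t}"] s by (auto intro!: continuous_intros)
    fix r assume r: "s < r" "r < t"
    have "(\<gamma> has_vector_derivative drift r (lift (\<gamma> r))) (at r)"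
      using \<gamma>[of r] r s at_within_Icc_at[of 0 r "t+1"] by simp
    then have "((\<lambda>r. Im (\<gamma> r)) has_vector_derivative Im (drift r (lift (\<gamma> r)))) (at r)"
      by (rule bounded_linear.has_vector_derivative[OF bounded_linear_Im])
    then show "\<exists>y. ((\<lambda>r. Im (\<gamma> r)) has_real_derivative y) (at r) \<and> y \<le> 0"
      using Im_drift_nonpos[of r "lift (\<gamma> r)"] lift_Im[of "\<gamma> r"] d r s
      by (auto simp: has_real_derivative_iff_has_vector_derivative)
  qed
  obtain \<eta> where \<eta>: "\<eta> > 0" "\<And>s. s \<in> {0..t+1} \<Longrightarrow> dist s t < \<eta> \<Longrightarrow> dist (\<gamma> s) (\<gamma> t) < d"
    using cont d t unfolding continuous_on_iff by (metis atLeastAtMost_iff le_add_same_cancel1 zero_le_one)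
  define T where "T = t + min \<eta> 1"
  have T: "t < T" "T \<le> t + 1" "T \<le> t + \<eta>" using \<eta>(1) by (auto simp: T_def)
  have high: "d \<le> Im (\<gamma> s)" if s: "0 \<le> s" "s < T" for s
  proof (cases "s \<le> t")
    case True
    then show ?thesis using anti[OF s(1)] w by (simp add: \<gamma>t d_def)
  next
    case False
    then have "dist (\<gamma> s) w < d" using \<eta>(2)[of s] s T by (simp add: \<gamma>t dist_real_def)
    then have "\<bar>Im (\<gamma> s - w)\<bar> < d"
      using abs_Im_le_cmod[of "\<gamma> s - w"] by (simp add: dist_norm)
    then show ?thesis unfolding d_def minus_complex.sel by linarith
  qed
  have "loewner_solution \<mu> (\<gamma> 0) (ereal T) \<gamma>"
    unfolding loewner_solution_def drift_def[symmetric]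
  proof (intro conjI allI impI refl)
    fix s assume s: "0 \<le> s \<and> ereal s < ereal T"
    then have h: "d \<le> Im (\<gamma> s)" using high by simp
    then show "\<gamma> s \<in> upper_half_plane" using d by (simp add: upper_half_plane_def)
    have "(\<gamma> has_vector_derivative drift s (\<gamma> s)) (at s within {0..t+1})"
      using \<gamma>[of s] s T by (simp add: lift_id[OF h])
    then show "(\<gamma> has_vector_derivative drift s (\<gamma> s)) (at s within {s. 0 \<le> s \<and> ereal s < ereal T})"
      by (rule has_vector_derivative_within_subset) (use T in auto)
  qed
  then show ?thesis using that T(1) \<gamma>t by blast
qed

lemma loewner_solution_imp_trajectory:
  assumes "loewner_solution \<mu> z T \<gamma>" "ereal t < T"
  shows "trajectory t \<gamma>"
  unfolding trajectory_def
proof (intro ballI conjI)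
  fix s assume s: "s \<in> {0..t}"
  have sT: "ereal r < T" if "r \<le> t" for r
    using that assms(2) by (meson ereal_less_eq(3) le_less_trans)
  show "0 < Im (\<gamma> s)"
    using assms(1) s sT[of s] by (simp add: loewner_solution_def upper_half_plane_def)
  show "(\<gamma> has_vector_derivative drift s (\<gamma> s)) (at s within {0..t})"
    using assms(1) s sT unfolding loewner_solution_def drift_def[symmetric]
    by (auto intro!: has_vector_derivative_within_subset[of _ _ s "{s. 0 \<le> s \<and> ereal s < T}" "{0..t}"])
qed

lemma trajectory_displacement:
  assumes tr: "trajectory t a" and t: "0 \<le> t"
  shows "norm (a 0 - a t) \<le> B * t / Im (a t)"
proof -
  have p: "0 < Im (a t)" using tr t by (simp add: trajectory_def)
  have "((\<lambda>s. drift s (a s)) has_integral (a t - a 0)) {0..t}"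
    by (rule fundamental_theorem_of_calculus[OF t]) (use tr in \<open>simp add: trajectory_def\<close>)
  then have "norm (a t - a 0) \<le> B / Im (a t) * measure lborel {0..t}"
    using p B_nonneg norm_drift_le trajectory_Im_antimono[OF tr]
    by (intro has_integral_bound_real[where S = "{}" and f = "\<lambda>s. drift s (a s)"]) auto
  then show ?thesis using t by (simp add: norm_minus_commute)
qed

lemma resolvent_product_diff_le:
  assumes s: "0 \<le> s" and d: "0 < d" "d \<le> Im (a s)" "d \<le> Im (b s)"
  shows "norm (resolvent_product a b s - resolvent_product a a s) \<le> B * norm (a s - b s) / d ^ 3"
proof -
  have im: "0 < Im (a s)" "0 < Im (b s)" using d by auto
  note c = continuous_on_mult[OF continuous_resolvent continuous_resolvent]
  have eq: "1 / (a s - complex_of_real x) * (1 / (b s - complex_of_real x)) - 1 / (a s - complex_of_real x) * (1 / (a s - complex_of_real x))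
    = 1 / (a s - complex_of_real x) * (1 / (b s - complex_of_real x) - 1 / (a s - complex_of_real x))" for x
    by (simp add: algebra_simps)
  have "resolvent_product a b s - resolvent_product a a s
     = (\<integral>x. 1 / (a s - complex_of_real x) * (1 / (b s - complex_of_real x) - 1 / (a s - complex_of_real x)) \<partial>\<mu> s)"
    unfolding resolvent_product_def eq[symmetric]
    by (intro Bochner_Integration.integral_diff[symmetric] integrable_bounded_continuous(1)[OF s c norm_resolvent_product_integrand_le])
       (rule im d)+
  also have "norm \<dots> \<le> 1 / d * (norm (b s - a s) / d\<^sup>2) * B"
  proof (rule integrable_bounded_continuous(2)[OF s])
    show "continuous_on UNIV (\<lambda>x. 1 / (a s - complex_of_real x) * (1 / (b s - complex_of_real x) - 1 / (a s - complex_of_real x)))"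
      by (intro continuous_on_mult continuous_on_diff continuous_resolvent im)
    show "norm (1 / (a s - complex_of_real x) * (1 / (b s - complex_of_real x) - 1 / (a s - complex_of_real x))) \<le> 1 / d * (norm (b s - a s) / d\<^sup>2)" for x
      unfolding norm_mult using d
      by (intro mult_mono norm_resolvent_le norm_resolvent_diff_le) auto
  qed
  finally show ?thesis
    by (simp add: power3_eq_cube power2_eq_square norm_minus_commute mult_ac)
qed

text \<open>Trajectories are indexed here by their endpoint at time \<open>t\<close>. By \<open>trajectory_difference\<close> the difference
  quotient of the starting points is the exponential of an integral along two trajectories. The same
  formula on \<open>[s, t]\<close> bounds the distance of the trajectories by a multiple of that of the endpoints,
  so this integral converges as the endpoints merge.\<close>

theorem initial_value_differentiable:
  assumes t: "0 \<le> t"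
    and tr: "\<And>w. 0 < Im w \<Longrightarrow> trajectory t (\<Gamma> w)" and fin: "\<And>w. 0 < Im w \<Longrightarrow> \<Gamma> w t = w"
    and w: "0 < Im w"
  shows "((\<lambda>w. \<Gamma> w 0) has_field_derivative exp (integral {0..t} (resolvent_product (\<Gamma> w) (\<Gamma> w)))) (at w)"
proof -
  define d where "d = Im w / 2"
  have d: "d > 0" using w by (simp add: d_def)
  define I where "I w' = integral {0..t} (resolvent_product (\<Gamma> w) (\<Gamma> w'))" for w'
  have near: "d \<le> Im w'" if "w' \<in> ball w d" for w'
  proof -
    have "\<bar>Im (w - w')\<bar> < d" using that abs_Im_le_cmod[of "w - w'"] by (simp add: dist_norm)
    then show ?thesis unfolding d_def minus_complex.sel by linarith
  qed
  have high: "d \<le> Im (\<Gamma> w' s)" if "w' \<in> ball w d" "0 \<le> s" "s \<le> t" for w' s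
  proof -
    have p: "0 < Im w'" using near[OF that(1)] d by simp
    show ?thesis using trajectory_Im_antimono[OF tr[OF p] that(2,3)] near[OF that(1)] by (simp add: fin[OF p])
  qed
  have wd: "w \<in> ball w d" using d by simp
  have cont: "continuous_on {0..t} (resolvent_product (\<Gamma> w) (\<Gamma> w'))" if w': "w' \<in> ball w d" for w'
  proof -
    have p: "0 < Im w'" using near[OF w'] d by simp
    show ?thesis
      using high[OF wd] high[OF w']
      by (intro continuous_on_resolvent_product[OF _ trajectory_continuous[OF tr[OF w]] trajectory_continuous[OF tr[OF p]] d]) auto
  qed
  define M where "M = exp (B / d\<^sup>2 * t)"
  have close: "norm (I w' - I w) \<le> B * M * t / d ^ 3 * norm (w' - w)" if w': "w' \<in> ball w d" for w'
  proof -
    have p: "0 < Im w'" using near[OF w'] d by simp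
    have gap: "norm (\<Gamma> w s - \<Gamma> w' s) \<le> norm (w - w') * M" if s: "s \<in> {0..t}" for s
    proof -
      have "norm (integral {s..t} (resolvent_product (\<Gamma> w) (\<Gamma> w'))) \<le> B / (d * d) * (t - s)"
      proof (rule integral_bound)
        show "continuous_on {s..t} (resolvent_product (\<Gamma> w) (\<Gamma> w'))"
          by (rule continuous_on_subset[OF cont[OF w']]) (use s in auto)
        show "norm (resolvent_product (\<Gamma> w) (\<Gamma> w') r) \<le> B / (d * d)" if "r \<in> {s..t}" for r
          using that s by (intro norm_resolvent_product_le d high w' wd) auto
      qed (use s in auto)
      also have "\<dots> \<le> B / d\<^sup>2 * t"
        using s B_nonneg by (auto simp: power2_eq_square intro!: mult_left_mono divide_right_mono)
      finally have "norm (exp (integral {s..t} (resolvent_product (\<Gamma> w) (\<Gamma> w')))) \<le> M"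
        unfolding M_def using norm_exp order_trans exp_le_cancel_iff by blast
      then show ?thesis
        using trajectory_difference[OF tr[OF w] tr[OF p], of s] s
        by (simp add: fin w p norm_mult mult_left_mono)
    qed
    have int: "resolvent_product (\<Gamma> w) (\<Gamma> v) integrable_on {0..t}" if "v \<in> ball w d" for v
      by (rule integrable_continuous_real[OF cont[OF that]])
    have "I w' - I w = integral {0..t} (\<lambda>s. resolvent_product (\<Gamma> w) (\<Gamma> w') s - resolvent_product (\<Gamma> w) (\<Gamma> w) s)"
      unfolding I_def by (rule Henstock_Kurzweil_Integration.integral_diff[OF int[OF w'] int[OF wd], symmetric])
    also have "norm \<dots> \<le> B * (norm (w - w') * M) / d ^ 3 * (t - 0)"
    proof (rule integral_bound[OF t])
      show "continuous_on {0..t} (\<lambda>s. resolvent_product (\<Gamma> w) (\<Gamma> w') s - resolvent_product (\<Gamma> w) (\<Gamma> w) s)"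
        by (intro continuous_on_diff cont w' wd)
      fix s assume s: "s \<in> {0..t}"
      have "norm (resolvent_product (\<Gamma> w) (\<Gamma> w') s - resolvent_product (\<Gamma> w) (\<Gamma> w) s) \<le> B * norm (\<Gamma> w s - \<Gamma> w' s) / d ^ 3"
        using s by (intro resolvent_product_diff_le d high w' wd) auto
      also have "\<dots> \<le> B * (norm (w - w') * M) / d ^ 3"
        using gap[OF s] B_nonneg d by (intro divide_right_mono mult_left_mono) auto
      finally show "norm (resolvent_product (\<Gamma> w) (\<Gamma> w') s - resolvent_product (\<Gamma> w) (\<Gamma> w) s) \<le> B * (norm (w - w') * M) / d ^ 3" .
    qed
    finally show ?thesis by (simp add: norm_minus_commute mult_ac)
  qed
  have ev: "\<forall>\<^sub>F w' in at w. w' \<in> ball w d"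
    by (rule eventually_at_in_open'[OF open_ball wd])
  have "((\<lambda>w'. I w' - I w) \<longlongrightarrow> 0) (at w)"
  proof (rule Lim_null_comparison)
    show "\<forall>\<^sub>F w' in at w. norm (I w' - I w) \<le> B * M * t / d ^ 3 * norm (w' - w)"
      using ev by (rule eventually_mono) (rule close)
    have "((\<lambda>w'. B * M * t / d ^ 3 * norm (w' - w)) \<longlongrightarrow> B * M * t / d ^ 3 * norm (w - w)) (at w)"
      by (intro tendsto_intros)
    then show "((\<lambda>w'. B * M * t / d ^ 3 * norm (w' - w)) \<longlongrightarrow> 0) (at w)" by simp
  qed
  then have "(I \<longlongrightarrow> I w) (at w)" by (simp add: LIM_zero_iff)
  then have "((\<lambda>w'. exp (I w')) \<longlongrightarrow> exp (I w)) (at w)" by (rule tendsto_exp)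
  moreover have "\<forall>\<^sub>F w' in at w. exp (I w') = (\<Gamma> w' 0 - \<Gamma> w 0) / (w' - w)"
    using ev eventually_neq_at_within[of w w UNIV]
  proof eventually_elim
    case (elim w')
    have p: "0 < Im w'" using near[OF elim(1)] d by simp
    have "\<Gamma> w 0 - \<Gamma> w' 0 = (w - w') * exp (I w')"
      using trajectory_difference[OF tr[OF w] tr[OF p], of 0] t by (simp add: fin w p I_def)
    then have "\<Gamma> w' 0 - \<Gamma> w 0 = (w' - w) * exp (I w')" by (simp add: algebra_simps)
    then show ?case using elim(2) by simp
  qed
  ultimately have "((\<lambda>w'. (\<Gamma> w' 0 - \<Gamma> w 0) / (w' - w)) \<longlongrightarrow> exp (I w)) (at w)"
    by (rule Lim_transform_eventually)
  then show ?thesis by (simp add: has_field_derivative_iff I_def)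
qed

section \<open>The inverse Loewner map as a reciprocal Cauchy transform\<close>

text \<open>The set \<open>E\<close> of points that survive beyond time \<open>t\<close> is mapped bijectively onto the half-plane by \<open>g t\<close>:
  surjectivity comes from the trajectories through given endpoints, injectivity from
  \<open>trajectory_difference\<close>. As the image of the injective holomorphic inverse, \<open>E\<close> is open, so passing to the
  closure in the definition of the hull removes no point of \<open>E\<close>.\<close>

theorem inverse_loewner_map:
  assumes g: "loewner_flow \<mu> g" and t: "0 \<le> t"
  defines "\<phi> \<equiv> inv_into (upper_half_plane - loewner_hull \<mu> t) (g t)"
  shows "\<phi> holomorphic_on {w. 0 < Im w}"
    and "\<And>w. 0 < Im w \<Longrightarrow> Im w \<le> Im (\<phi> w)"
    and "\<And>w. 0 < Im w \<Longrightarrow> norm (\<phi> w - w) \<le> B * t / Im w"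
proof -
  let ?H = "{w. 0 < Im w}"
  define E where "E = {z \<in> upper_half_plane. ereal t < existence_time \<mu> z}"
  have sol: "loewner_solution \<mu> z (existence_time \<mu> z) (\<lambda>s. g s z)" if "z \<in> E" for z
    using g that by (simp add: loewner_flow_def E_def)
  have trE: "trajectory t (\<lambda>s. g s z)" if "z \<in> E" for z
    using loewner_solution_imp_trajectory[OF sol[OF that]] that by (simp add: E_def)
  have start: "g 0 z = z" if "z \<in> E" for z
    using sol[OF that] by (simp add: loewner_solution_def)
  have surj: "\<exists>z\<in>E. g t z = w" if w: "0 < Im w" for w
  proof -
    obtain \<gamma> T where \<gamma>: "t < T" "\<gamma> t = w" "loewner_solution \<mu> (\<gamma> 0) (ereal T) \<gamma>"
      using solution_through_point[OF t w] by blast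
    have tr: "trajectory t \<gamma>" using loewner_solution_imp_trajectory[OF \<gamma>(3)] \<gamma>(1) by simp
    have "ereal T \<le> existence_time \<mu> (\<gamma> 0)"
      unfolding existence_time_def using \<gamma>(3) by (intro Sup_upper) blast
    then have "ereal t < existence_time \<mu> (\<gamma> 0)" using \<gamma>(1) by (meson ereal_less(1) less_ereal.simps(1) less_le_trans)
    then have E: "\<gamma> 0 \<in> E" using tr t by (simp add: E_def upper_half_plane_def trajectory_def)
    \<comment> \<open>Both curves start at \<open>\<gamma> 0\<close>, hence they agree at time \<open>t\<close>.\<close>
    have "0 = (g t (\<gamma> 0) - \<gamma> t) * exp (integral {0..t} (resolvent_product (\<lambda>s. g s (\<gamma> 0)) \<gamma>))"
      using trajectory_difference[OF trE[OF E] tr order_refl t] start[OF E] by simp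
    then have "g t (\<gamma> 0) = w" using \<gamma>(2) by simp
    then show ?thesis using E by blast
  qed
  have inj: "inj_on (g t) E"
  proof (rule inj_onI)
    fix y z assume yz: "y \<in> E" "z \<in> E" "g t y = g t z"
    show "y = z"
      using trajectory_difference[OF trE[OF yz(1)] trE[OF yz(2)] order_refl t] yz by (simp add: start)
  qed
  define \<psi> where "\<psi> = inv_into E (g t)"
  have \<psi>E: "\<psi> w \<in> E" and g\<psi>: "g t (\<psi> w) = w" if "0 < Im w" for w
    using surj[OF that] unfolding \<psi>_def by (auto intro!: inv_into_into f_inv_into_f)
  have tr\<psi>: "trajectory t (\<lambda>s. g s (\<psi> w))" if "0 < Im w" for w
    using trE[OF \<psi>E[OF that]] .
  have deriv: "(\<psi> has_field_derivative exp (integral {0..t} (resolvent_product (\<lambda>s. g s (\<psi> w)) (\<lambda>s. g s (\<psi> w))))) (at w)"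
    if w: "0 < Im w" for w
  proof -
    have "((\<lambda>w. g 0 (\<psi> w)) has_field_derivative exp (integral {0..t} (resolvent_product (\<lambda>s. g s (\<psi> w)) (\<lambda>s. g s (\<psi> w))))) (at w)"
      using initial_value_differentiable[of t "\<lambda>w s. g s (\<psi> w)" w, OF t tr\<psi> g\<psi> w] .
    then show ?thesis
      by (rule has_field_derivative_transform_within_open[OF _ open_halfspace_Im_gt[of 0]])
         (use w start \<psi>E in auto)
  qed
  have hol: "\<psi> holomorphic_on ?H"
    using deriv by (auto simp: holomorphic_on_def field_differentiable_def intro: has_field_derivative_at_within)
  have "inj_on \<psi> ?H" by (rule inj_on_inverseI[of _ "g t"]) (simp add: g\<psi>)
  then have "open (\<psi> ` ?H)"
    by (rule open_mapping_thm3[OF hol open_halfspace_Im_gt])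
  moreover have "\<psi> ` ?H = E"
  proof (intro equalityI subsetI)
    fix z assume z: "z \<in> E"
    have "0 < Im (g t z)" using trE[OF z] t by (simp add: trajectory_def)
    moreover have "z = \<psi> (g t z)" using z inj by (simp add: \<psi>_def)
    ultimately show "z \<in> \<psi> ` ?H" by blast
  qed (use \<psi>E in auto)
  ultimately have "open E" by simp
  have hull: "upper_half_plane - loewner_hull \<mu> t = E"
  proof -
    have c: "{z \<in> upper_half_plane. existence_time \<mu> z \<le> ereal t} = upper_half_plane - E"
      by (auto simp: E_def not_less)
    have "E \<inter> closure (upper_half_plane - E) = {}"
      using \<open>open E\<close> by (subst open_Int_closure_eq_empty) auto
    moreover have "E \<subseteq> upper_half_plane" by (auto simp: E_def)
    ultimately show ?thesis
      unfolding loewner_hull_def c using closure_subset[of "upper_half_plane - E"] by blast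
  qed
  have \<phi>: "\<phi> = \<psi>" unfolding \<phi>_def \<psi>_def hull ..
  show "\<phi> holomorphic_on ?H" unfolding \<phi> by (rule hol)
  show "Im w \<le> Im (\<phi> w)" if w: "0 < Im w" for w
    using trajectory_Im_antimono[OF tr\<psi>[OF w] order_refl t] start[OF \<psi>E[OF w]]
    by (simp add: \<phi> g\<psi>[OF w])
  show "norm (\<phi> w - w) \<le> B * t / Im w" if w: "0 < Im w" for w
    using trajectory_displacement[OF tr\<psi>[OF w] t] start[OF \<psi>E[OF w]]
    by (simp add: \<phi> g\<psi>[OF w])
qed

end

text \<open>The estimate \<open>|F z - z| \<le> K / Im z\<close> forces \<open>\<i> y / F(\<i> y) \<rightarrow> 1\<close>, the normalisation in Nevanlinna's theorem.\<close>

lemma reciprocal_cauchy_transform_representation: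
  assumes hol: "F holomorphic_on {z. 0 < Im z}"
    and up: "\<And>z. 0 < Im z \<Longrightarrow> Im z \<le> Im (F z)"
    and near: "\<And>z. 0 < Im z \<Longrightarrow> norm (F z - z) \<le> K / Im z"
  shows "\<exists>\<nu>. real_distribution \<nu> \<and> (\<forall>z. 0 < Im z \<longrightarrow> 1 / F z = (\<integral>x. 1 / (z - complex_of_real x) \<partial>\<nu>))"
proof (rule cauchy_transform_representation)
  have pos: "0 < Im (F z)" if "0 < Im z" for z using up[OF that] that by simp
  then have nz: "F z \<noteq> 0" if "0 < Im z" for z using that by fastforce
  show "(\<lambda>z. 1 / F z) holomorphic_on {z. 0 < Im z}"
    using nz by (intro holomorphic_intros hol) auto
  show "Im (1 / F z) < 0" if "0 < Im z" for z
    using pos[OF that] nz[OF that] by (simp add: Im_divide complex_neq_0)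
  have "((\<lambda>y. \<i> * complex_of_real y * (1 / F (\<i> * complex_of_real y)) - 1) \<longlongrightarrow> 0) at_top"
  proof (rule Lim_null_comparison)
    show "\<forall>\<^sub>F y in at_top. norm (\<i> * complex_of_real y * (1 / F (\<i> * complex_of_real y)) - 1) \<le> K * (inverse y * inverse y)"
    proof (rule eventually_mono[OF eventually_gt_at_top[of 0]])
      fix y :: real assume y: "y > 0"
      define z where "z = \<i> * complex_of_real y"
      have z: "Im z = y" by (simp add: z_def)
      have n: "F z \<noteq> 0" using nz[of z] y z by simp
      have "y \<le> norm (F z)" using up[of z] y z abs_Im_le_cmod[of "F z"] by simp
      have "norm (z * (1 / F z) - 1) = norm (F z - z) / norm (F z)"
        using n by (simp add: norm_divide[symmetric] norm_minus_commute diff_divide_distrib)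
      also have "\<dots> \<le> (K / y) / y"
        using near[of z] y z \<open>y \<le> norm (F z)\<close> by (intro frac_le) (auto intro: order_trans[OF norm_ge_zero])
      finally show "norm (\<i> * complex_of_real y * (1 / F (\<i> * complex_of_real y)) - 1) \<le> K * (inverse y * inverse y)"
        by (simp add: z_def[symmetric] divide_inverse mult.assoc)
    qed
    have "((\<lambda>y::real. K * (inverse y * inverse y)) \<longlongrightarrow> K * (0 * 0)) at_top"
      by (intro tendsto_mult tendsto_const tendsto_inverse_0_at_top filterlim_ident)
    then show "((\<lambda>y::real. K * (inverse y * inverse y)) \<longlongrightarrow> 0) at_top" by simp
  qed
  then show "((\<lambda>y. \<i> * complex_of_real y * (1 / F (\<i> * complex_of_real y))) \<longlongrightarrow> 1) at_top"
    by (simp only: LIM_zero_iff)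
qed

text \<open>Preimages of the generating sets of the weak topology are exactly the sets that continuity of
  \<open>t \<mapsto> \<integral> \<phi> d\<mu>\<^sub>t\<close> requires to be open.\<close>

lemma P_b_M0_imp_bounded_measure_path:
  assumes \<mu>: "\<mu> \<in> P_b_M0"
  shows "\<exists>B. bounded_measure_path \<mu> B"
proof -
  define b where "b = (SUP t\<in>{0..}. emeasure (\<mu> t) UNIV)"
  have b: "b < \<infinity>" and cm: "continuous_map (top_of_set {0..}) weak_topology \<mu>"
    using \<mu> by (auto simp: P_b_M0_def b_def)
  have "topspace weak_topology \<subseteq> M0" unfolding weak_topology_def by auto
  then have M0: "\<mu> t \<in> M0" if "0 \<le> t" for t
    using continuous_map_image_subset_topspace[OF cm] that by fastforce
  have "bounded_measure_path \<mu> (enn2real b)"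
  proof (rule bounded_measure_path.intro)
    fix t :: real assume t: "0 \<le> t"
    show fb: "finite_borel_measure (\<mu> t)" using M0[OF t] by (simp add: M0_def)
    have "emeasure (\<mu> t) UNIV \<le> b" unfolding b_def using t by (intro SUP_upper) auto
    then show "measure (\<mu> t) UNIV \<le> enn2real b"
      unfolding measure_def using b by (intro enn2real_mono) auto
  next
    fix \<phi> :: "real \<Rightarrow> real" assume \<phi>: "continuous_on UNIV \<phi>" "bounded (range \<phi>)"
    show "continuous_on {0..} (\<lambda>t. \<integral>x. \<phi> x \<partial>\<mu> t)"
      unfolding continuous_on_open_invariant
    proof (intro allI impI)
      fix U :: "real set" assume U: "open U"
      define N where "N = {M \<in> M0. (\<integral>x. \<phi> x \<partial>M) \<in> U}"
      have "openin weak_topology N"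
        unfolding weak_topology_def by (rule topology_generated_by_Basis) (use \<phi> U in \<open>auto simp: N_def\<close>)
      then have "openin (top_of_set {0..}) {t \<in> topspace (top_of_set {0..}). \<mu> t \<in> N}"
        by (rule openin_continuous_map_preimage[OF cm])
      then obtain A where A: "open A" "{t \<in> {0..}. \<mu> t \<in> N} = {0..} \<inter> A"
        by (auto simp: openin_open)
      moreover have "{t \<in> {0..}. \<mu> t \<in> N} = (\<lambda>t. \<integral>x. \<phi> x \<partial>\<mu> t) -` U \<inter> {0..}"
        using M0 by (auto simp: N_def)
      ultimately show "\<exists>A. open A \<and> A \<inter> {0..} = (\<lambda>t. \<integral>x. \<phi> x \<partial>\<mu> t) -` U \<inter> {0..}"
        by (metis Int_commute)
    qed
  qed
  then show ?thesis ..
qed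

theorem lemma2:
  fixes \<mu> :: "real \<Rightarrow> real measure"
    and g f G :: "real \<Rightarrow> complex \<Rightarrow> complex"
  assumes "\<mu> \<in> P_b_M0"
    and "loewner_flow \<mu> g"
    and "\<And>t z. 0 \<le> t \<Longrightarrow> z \<in> upper_half_plane \<Longrightarrow>
           f t z = inv_into (upper_half_plane - loewner_hull \<mu> t) (g t) z"
    and "\<And>t z. 0 \<le> t \<Longrightarrow> z \<in> upper_half_plane \<Longrightarrow> G t z = 1 / f t z"
  shows "\<forall>t\<ge>0. \<exists>!\<nu>. real_distribution \<nu> \<and>
           (\<forall>z\<in>upper_half_plane. G t z = (\<integral>x. 1 / (z - complex_of_real x) \<partial>\<nu>))"
proof (intro allI impI)
  fix t :: real assume t: "0 \<le> t"
  obtain B where "bounded_measure_path \<mu> B"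
    using P_b_M0_imp_bounded_measure_path[OF assms(1)] by blast
  then interpret bounded_measure_path \<mu> B .
  let ?\<phi> = "inv_into (upper_half_plane - loewner_hull \<mu> t) (g t)"
  have G: "G t z = 1 / ?\<phi> z" if "z \<in> upper_half_plane" for z
    using assms(3,4)[OF t that] by simp
  have "\<exists>\<nu>. real_distribution \<nu> \<and> (\<forall>z. 0 < Im z \<longrightarrow> 1 / ?\<phi> z = (\<integral>x. 1 / (z - complex_of_real x) \<partial>\<nu>))"
    by (rule reciprocal_cauchy_transform_representation[OF inverse_loewner_map[OF assms(2) t]])
  then obtain \<nu> where \<nu>: "real_distribution \<nu>"
    "\<And>z. 0 < Im z \<Longrightarrow> 1 / ?\<phi> z = (\<integral>x. 1 / (z - complex_of_real x) \<partial>\<nu>)" by blast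
  show "\<exists>!\<nu>. real_distribution \<nu> \<and>
           (\<forall>z\<in>upper_half_plane. G t z = (\<integral>x. 1 / (z - complex_of_real x) \<partial>\<nu>))"
  proof (rule ex1I[of _ \<nu>])
    show *: "real_distribution \<nu> \<and> (\<forall>z\<in>upper_half_plane. G t z = (\<integral>x. 1 / (z - complex_of_real x) \<partial>\<nu>))"
      using \<nu> G by (simp add: upper_half_plane_def)
    fix N assume N: "real_distribution N \<and>
        (\<forall>z\<in>upper_half_plane. G t z = (\<integral>x. 1 / (z - complex_of_real x) \<partial>N))"
    show "N = \<nu>"
    proof (rule cauchy_transform_eq_imp_eq)
      fix z :: complex assume "0 < Im z"
      then have "z \<in> upper_half_plane" by (simp add: upper_half_plane_def)
      then show "(\<integral>x. 1 / (z - complex_of_real x) \<partial>N) = (\<integral>x. 1 / (z - complex_of_real x) \<partial>\<nu>)"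
        using N * by metis
    qed (use N \<nu> in auto)
  qed
qed

end
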